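(* Let $t\ge s\ge k$, where $k\in\{2,3\}$. Let $G$ be a $k$-connected bipartite graph whose partition classes have $s$ and $t$ vertices, and let $H\subset G$ be a minimum spanning $k$-connected subgraph. If $e(H)=kt$, then \[ mc_k(G)=e(G)-kt+1. \] Moreover, if $s=t$, then the same conclusion holds for every $k\in\{2,3,4,5\}$ (with $t\ge k$).
   Context: All graphs are finite, simple and undirected. A graph is $k$-connected if it has at least $k+1$ vertices and remains connected after deleting any at most $k-1$ vertices. Paths are called disjoint if they are internally vertex-disjoint. An edge-coloured path is monochromatic if all its edges have the same colour. For a $k$-connected graph $G$, an edge-colouring is monochromatic $k$-connected if any two vertices are connected by $k$ disjoint monochromatic paths; $mc_k(G)$ is the maximum number of colours in a monochromatic $k$-connected colouring of $G$. A minimum spanning $k$-connected subgraph of $G$ is a $k$-connected subgraph $H$ with $V(H)=V(G)$ and $e(H)$ minimum among such subgraphs. *)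

theory Defs
  imports Main
begin

definition simple_graph :: "'a set \<Rightarrow> 'a set set \<Rightarrow> bool" where
  "simple_graph V E \<longleftrightarrow> finite V \<and>
     (\<forall>e\<in>E. \<exists>u v. u \<in> V \<and> v \<in> V \<and> u \<noteq> v \<and> e = {u, v})"

definition path_edges :: "'a list \<Rightarrow> 'a set set" where
  "path_edges P = set (map (\<lambda>(u, v). {u, v}) (zip P (tl P)))"

definition is_path :: "'a set set \<Rightarrow> 'a list \<Rightarrow> bool" where
  "is_path E P \<longleftrightarrow> P \<noteq> [] \<and> distinct P \<and> path_edges P \<subseteq> E"

definition inner_vertices :: "'a list \<Rightarrow> 'a set" where
  "inner_vertices P = set (butlast (tl P))"

definition connected_on :: "'a set set \<Rightarrow> 'a set \<Rightarrow> bool" where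
  "connected_on E W \<longleftrightarrow> (\<forall>u\<in>W. \<forall>v\<in>W. \<exists>P. is_path E P \<and> hd P = u \<and> last P = v \<and> set P \<subseteq> W)"

definition k_connected :: "nat \<Rightarrow> 'a set \<Rightarrow> 'a set set \<Rightarrow> bool" where
  "k_connected k V E \<longleftrightarrow> simple_graph V E \<and> card V \<ge> k + 1 \<and>
     (\<forall>S. S \<subseteq> V \<and> card S \<le> k - 1 \<longrightarrow> connected_on E (V - S))"

definition monochromatic :: "('a set \<Rightarrow> 'c) \<Rightarrow> 'a list \<Rightarrow> bool" where
  "monochromatic c P \<longleftrightarrow> (\<exists>col. \<forall>e\<in>path_edges P. c e = col)"

definition k_mono_linked :: "nat \<Rightarrow> 'a set set \<Rightarrow> ('a set \<Rightarrow> 'c) \<Rightarrow> 'a \<Rightarrow> 'a \<Rightarrow> bool" where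
  "k_mono_linked k E c x y \<longleftrightarrow> (\<exists>Ps. finite Ps \<and> card Ps = k \<and>
     (\<forall>P\<in>Ps. is_path E P \<and> hd P = x \<and> last P = y \<and> monochromatic c P) \<and>
     (\<forall>P\<in>Ps. \<forall>Q\<in>Ps. P \<noteq> Q \<longrightarrow> inner_vertices P \<inter> inner_vertices Q = {}))"

definition mono_k_connected_colouring :: "nat \<Rightarrow> 'a set \<Rightarrow> 'a set set \<Rightarrow> ('a set \<Rightarrow> 'c) \<Rightarrow> bool" where
  "mono_k_connected_colouring k V E c \<longleftrightarrow>
     (\<forall>x\<in>V. \<forall>y\<in>V. x \<noteq> y \<longrightarrow> k_mono_linked k E c x y)"

text \<open>Colours are natural numbers (any countable supply suffices); the number of colours
  used is the number of distinct colours on the edges.\<close>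
definition mc :: "nat \<Rightarrow> 'a set \<Rightarrow> 'a set set \<Rightarrow> nat" where
  "mc k V E = Max {card (c ` E) | c :: 'a set \<Rightarrow> nat. mono_k_connected_colouring k V E c}"

definition bipartite_parts :: "'a set \<Rightarrow> 'a set set \<Rightarrow> nat \<Rightarrow> nat \<Rightarrow> bool" where
  "bipartite_parts V E s t \<longleftrightarrow> (\<exists>A B. A \<inter> B = {} \<and> A \<union> B = V \<and> card A = s \<and> card B = t \<and>
     (\<forall>e\<in>E. \<exists>a\<in>A. \<exists>b\<in>B. e = {a, b}))"

definition min_spanning_k_connected :: "nat \<Rightarrow> 'a set \<Rightarrow> 'a set set \<Rightarrow> 'a set set \<Rightarrow> bool" where
  "min_spanning_k_connected k V E F \<longleftrightarrow> F \<subseteq> E \<and> k_connected k V F \<and>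
     (\<forall>F'. F' \<subseteq> E \<and> k_connected k V F' \<longrightarrow> card F \<le> card F')"

end

theory Submission
  imports Defs
begin

text \<open>
  For the lower bound, give \<open>F\<close> one colour and all other edges different colours;
  Menger's theorem provides the paths inside \<open>F\<close>.

  For the upper bound, let \<open>e\<^sub>i\<close> be the number of edges of colour \<open>i\<close> and \<open>d\<^sub>i\<close> the degree in
  colour \<open>i\<close>, where \<open>i\<close> ranges over the colours with at least two edges. We have to show that the
  waste \<open>\<Sum>(e\<^sub>i - 1)\<close> is at least \<open>kt - 1\<close>. Two vertices \<open>u\<close>, \<open>v\<close> of one class are not adjacent, so
  \<open>\<Sum>min (d\<^sub>i u) (d\<^sub>i v) \<ge> k\<close>. Suppose the waste is at most \<open>kt - 2\<close>.

  If \<open>k \<le> 3\<close>, summing over all \<open>u\<close> shows that each \<open>v\<close> in the class \<open>B\<close> of size \<open>t\<close> misses at most one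
  of these colours, which forces some \<open>v\<close> of total degree exactly \<open>k\<close>. Then \<open>d\<^sub>i u \<ge> d\<^sub>i v\<close> for
  all \<open>u\<close> in \<open>B\<close>, and the small waste yields a colour with \<open>d\<^sub>i = 1\<close> on all of \<open>B\<close>. It is a star
  using up all edges at its centre, which cannot be linked to the rest of its own class.

  If \<open>s = t\<close> and \<open>k \<le> 5\<close>, double counting over both classes shows that \<open>e\<^sub>i \<ge> 2t\<close> for all \<open>i\<close>. So there
  are two colours, every vertex has total degree \<open>k\<close>, and one colour is 2-regular, that is, a Hamilton cycle.
  Its two paths between \<open>u\<close> and \<open>v\<close> cover all vertices and leave no room for a third path.
\<close>

section \<open>Menger's theorem\<close>

text \<open>A separator may contain vertices of \<open>A\<close> and of \<open>B\<close>. The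
  closure is reflexive, so a vertex of \<open>A \<inter> B\<close> outside \<open>S\<close> already
  violates the condition; hence \<open>A \<inter> B \<subseteq> S\<close>.\<close>

definition separates :: "'a rel \<Rightarrow> 'a set \<Rightarrow> 'a set \<Rightarrow> 'a set \<Rightarrow> bool" where
  "separates r A B S \<longleftrightarrow> (\<forall>a\<in>A - S. \<forall>b\<in>B - S. (a, b) \<notin> (r \<inter> (- S) \<times> (- S))\<^sup>*)"

definition dipath :: "'a rel \<Rightarrow> 'a list \<Rightarrow> bool" where
  "dipath r p \<longleftrightarrow> p \<noteq> [] \<and> distinct p \<and> successively (\<lambda>u v. (u, v) \<in> r) p"

text \<open>Disjointness includes the end vertices, and one-vertex paths are allowed: a vertex of
  \<open>A \<inter> B\<close> forms a path by itself.\<close>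

definition disjoint_dipaths :: "'a rel \<Rightarrow> 'a set \<Rightarrow> 'a set \<Rightarrow> 'a list set \<Rightarrow> bool" where
  "disjoint_dipaths r A B Ps \<longleftrightarrow> finite Ps \<and>
     (\<forall>p\<in>Ps. dipath r p \<and> hd p \<in> A \<and> last p \<in> B) \<and>
     (\<forall>p\<in>Ps. \<forall>q\<in>Ps. p \<noteq> q \<longrightarrow> set p \<inter> set q = {})"

lemma separates_converse: "separates (r\<inverse>) B A S \<longleftrightarrow> separates r A B S"
proof -
  have "r\<inverse> \<inter> (- S) \<times> (- S) = (r \<inter> (- S) \<times> (- S))\<inverse>" by auto
  then show ?thesis
    unfolding separates_def by (auto simp: rtrancl_converse)
qed

lemma successively_imp_rtrancl:
  assumes "successively (\<lambda>u v. (u, v) \<in> r) p" "p \<noteq> []" "set p \<inter> S = {}"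
  shows "(hd p, last p) \<in> (r \<inter> (- S) \<times> (- S))\<^sup>*"
  using assms
proof (induction p)
  case (Cons a p)
  show ?case
  proof (cases p)
    case (Cons b q)
    then have "(a, b) \<in> r \<inter> (- S) \<times> (- S)" "(b, last p) \<in> (r \<inter> (- S) \<times> (- S))\<^sup>*"
      using Cons.IH Cons.prems by auto
    then show ?thesis using Cons by (auto intro: converse_rtrancl_into_rtrancl)
  qed auto
qed auto

text \<open>A walk from \<open>A\<close> cannot use the arc \<open>(x, y)\<close> before it reaches
  \<open>P\<close>, because \<open>x \<in> P\<close>; so if it avoids \<open>T\<close>, reaching
  \<open>P\<close> would contradict the choice of \<open>T\<close>. A walk that never reaches
  \<open>P\<close> cannot end in \<open>B\<close>.\<close>

lemma separates_if_separates_from_separator: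
  assumes P: "separates r A B P" and "x \<in> P"
    and T: "separates (r - {(x, y)}) A P T"
  shows "separates r A B T"
  unfolding separates_def
proof (intro ballI notI)
  fix a b assume a: "a \<in> A - T" and b: "b \<in> B - T"
    and ab: "(a, b) \<in> (r \<inter> (- T) \<times> (- T))\<^sup>*"
  define r' where "r' = (r - {(x, y)}) \<inter> (- T) \<times> (- T)"
  have noP: "(a, z) \<notin> r'\<^sup>*" if "z \<in> P - T" for z
    using T a that unfolding separates_def r'_def by blast
  have "(a, b) \<in> r'\<^sup>* \<and> (a, b) \<in> (r \<inter> (- P) \<times> (- P))\<^sup>* \<and> b \<notin> P"
    using ab
  proof (induction rule: rtrancl_induct)
    case base
    then show ?case using noP[of a] a by auto
  next
    case (step u v)
    then have "(u, v) \<in> r'" unfolding r'_def using \<open>x \<in> P\<close> by auto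
    with step have av: "(a, v) \<in> r'\<^sup>*" by auto
    then have "v \<notin> P" using noP[of v] step by auto
    then have "(u, v) \<in> r \<inter> (- P) \<times> (- P)" using step by auto
    with step av \<open>v \<notin> P\<close> show ?case by (meson rtrancl.rtrancl_into_rtrancl)
  qed
  moreover have "a \<notin> P" using noP[of a] a by auto
  ultimately show False using P a b unfolding separates_def by blast
qed

text \<open>Disjoint paths have different last vertices, so with as many paths as targets the map
  \<open>last\<close> is a bijection onto \<open>P\<close> and the paths can be indexed by their
  targets.\<close>

lemma disjoint_dipaths_onto_targets:
  assumes "disjoint_dipaths r A P Ps" "card Ps = card P" "finite P"
  obtains p where "\<And>z. z \<in> P \<Longrightarrow> dipath r (p z) \<and> hd (p z) \<in> A \<and> last (p z) = z"
    and "\<And>z w. z \<in> P \<Longrightarrow> w \<in> P \<Longrightarrow> z \<noteq> w \<Longrightarrow> set (p z) \<inter> set (p w) = {}"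
proof -
  have ne: "q \<noteq> []" if "q \<in> Ps" for q
    using assms(1) that unfolding disjoint_dipaths_def dipath_def by auto
  have inj: "inj_on last Ps"
  proof (rule inj_onI, rule ccontr)
    fix u v assume uv: "u \<in> Ps" "v \<in> Ps" "last u = last v" "u \<noteq> v"
    then have "last u \<in> set u \<inter> set v" using ne by (metis IntI last_in_set)
    then show False using assms(1) uv unfolding disjoint_dipaths_def by blast
  qed
  have "last ` Ps \<subseteq> P" using assms(1) unfolding disjoint_dipaths_def by auto
  moreover have "card (last ` Ps) = card P" using card_image[OF inj] assms by auto
  ultimately have img: "last ` Ps = P" using assms(3) by (simp add: card_subset_eq)
  define p where "p = inv_into Ps last"
  have pP: "p z \<in> Ps" "last (p z) = z" if "z \<in> P" for z
    using that img unfolding p_def by (auto simp: inv_into_into f_inv_into_f)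
  show thesis
  proof (rule that[of p])
    fix z assume "z \<in> P"
    then show "dipath r (p z) \<and> hd (p z) \<in> A \<and> last (p z) = z"
      using pP assms(1) unfolding disjoint_dipaths_def by auto
  next
    fix z w assume zw: "z \<in> P" "w \<in> P" "z \<noteq> w"
    then have "p z \<noteq> p w" using pP by metis
    then show "set (p z) \<inter> set (p w) = {}"
      using pP zw assms(1) unfolding disjoint_dipaths_def by blast
  qed
qed

lemma dipath_rev: "dipath (r\<inverse>) (rev p) \<longleftrightarrow> dipath r p"
  unfolding dipath_def by (simp add: successively_rev)

lemma disjoint_dipaths_rev:
  assumes "disjoint_dipaths r A B Ps"
  shows "disjoint_dipaths (r\<inverse>) B A (rev ` Ps)"
proof -
  have "p \<noteq> []" if "p \<in> Ps" for p
    using assms that unfolding disjoint_dipaths_def dipath_def by auto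
  then show ?thesis
    using assms unfolding disjoint_dipaths_def
    by (auto simp: dipath_rev hd_rev last_rev)
qed

lemma disjoint_dipaths_onto_sources:
  assumes "disjoint_dipaths r Q B Ps" "card Ps = card Q" "finite Q"
  obtains q where "\<And>z. z \<in> Q \<Longrightarrow> dipath r (q z) \<and> last (q z) \<in> B \<and> hd (q z) = z"
    and "\<And>z w. z \<in> Q \<Longrightarrow> w \<in> Q \<Longrightarrow> z \<noteq> w \<Longrightarrow> set (q z) \<inter> set (q w) = {}"
proof -
  have "card (rev ` Ps) = card Q" using assms(2) by (simp add: card_image)
  from disjoint_dipaths_onto_targets[OF disjoint_dipaths_rev[OF assms(1)] this assms(3)]
  obtain p where p: "\<And>z. z \<in> Q \<Longrightarrow> dipath (r\<inverse>) (p z) \<and> hd (p z) \<in> B \<and> last (p z) = z"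
    "\<And>z w. z \<in> Q \<Longrightarrow> w \<in> Q \<Longrightarrow> z \<noteq> w \<Longrightarrow> set (p z) \<inter> set (p w) = {}" by blast
  show thesis
  proof (rule that[of "\<lambda>z. rev (p z)"])
    fix z assume "z \<in> Q"
    with p(1)[of z] have "p z \<noteq> []" "dipath r (rev (p z))"
      using dipath_rev[of r "rev (p z)"] by (auto simp: dipath_def)
    with p(1)[OF \<open>z \<in> Q\<close>]
    show "dipath r (rev (p z)) \<and> last (rev (p z)) \<in> B \<and> hd (rev (p z)) = z"
      by (auto simp: hd_rev last_rev)
  qed (use p(2) in auto)
qed

lemma dipath_mono: "dipath r p \<Longrightarrow> r \<subseteq> r' \<Longrightarrow> dipath r' p"
  unfolding dipath_def by (auto elim: successively_mono)

lemma disjoint_dipaths_mono: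
  "disjoint_dipaths r A B Ps \<Longrightarrow> r \<subseteq> r' \<Longrightarrow> disjoint_dipaths r' A B Ps"
  unfolding disjoint_dipaths_def by (auto dest: dipath_mono)

text \<open>Goering's proof by induction on the number of arcs: if deleting the arc
  \<open>(x, y)\<close> produces a separator \<open>S\<close> that is too small, the paths from \<open>A\<close> to
  \<open>S \<union> {x}\<close> and from \<open>S \<union> {y}\<close> to \<open>B\<close> meet only in \<open>S\<close> and can be concatenated.\<close>
theorem Menger_sets:
  assumes "finite r" "finite A" "finite B"
    and "\<And>S. finite S \<Longrightarrow> separates r A B S \<Longrightarrow> k \<le> card S"
  shows "\<exists>Ps. disjoint_dipaths r A B Ps \<and> card Ps = k"
  using assms
proof (induction "card r" arbitrary: r A B rule: less_induct)
  case less
  show ?case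
  proof (cases "r = {}")
    case True
    \<comment> \<open>Without arcs only one-vertex paths exist, and \<open>A \<inter> B\<close> is
      itself a separator.\<close>
    have "separates r A B (A \<inter> B)" unfolding separates_def True by auto
    with less.prems have "k \<le> card (A \<inter> B)" by auto
    then obtain K where K: "K \<subseteq> A \<inter> B" "card K = k" "finite K"
      by (metis obtain_subset_with_card_n)
    have "disjoint_dipaths r A B ((\<lambda>a. [a]) ` K)"
      using K unfolding disjoint_dipaths_def dipath_def by auto
    moreover have "card ((\<lambda>a. [a]) ` K) = k" using K by (simp add: card_image inj_on_def)
    ultimately show ?thesis by blast
  next
    case False
    then obtain x y where xy: "(x, y) \<in> r" by auto
    define r' where "r' = r - {(x, y)}"
    have r': "r' \<subseteq> r" "finite r'" "card r' < card r"
      using xy less.prems(1) card_Diff1_less[of r "(x, y)"] unfolding r'_def by auto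
    show ?thesis
    proof (cases "\<forall>S. finite S \<longrightarrow> separates r' A B S \<longrightarrow> k \<le> card S")
      case True
      with less.hyps[of r' A B] r' less.prems
      obtain Ps where "disjoint_dipaths r' A B Ps" "card Ps = k" by blast
      then show ?thesis using disjoint_dipaths_mono r'(1) by blast
    next
      case False
      then obtain S where S: "finite S" "separates r' A B S" "card S < k" by auto
      define P Q where "P = insert x S" and "Q = insert y S"
      \<comment> \<open>A walk that avoids one end of the deleted arc cannot use this arc, so adding
        either end to \<open>S\<close> gives a separator for all of \<open>r\<close>.\<close>
      have avoid: "r \<inter> (- insert z S) \<times> (- insert z S) \<subseteq> r' \<inter> (- S) \<times> (- S)"
        if "z = x \<or> z = y" for z
        using that unfolding r'_def by auto
      have sepPQ: "separates r A B (insert z S)" if "z = x \<or> z = y" for z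
        using S(2) rtrancl_mono[OF avoid[OF that]] unfolding separates_def by blast
      have sepP: "separates r A B P" and sepQ: "separates r A B Q"
        unfolding P_def Q_def using sepPQ by auto
      have "k \<le> card P" "k \<le> card Q"
        using less.prems(4) sepP sepQ S(1) unfolding P_def Q_def by auto
      \<comment> \<open>\<open>S\<close> has fewer than \<open>k\<close> elements while
        \<open>P\<close> and \<open>Q\<close> have at least \<open>k\<close>, so both insertions are
        proper and both sizes are exactly \<open>k\<close>.\<close>
      then have nS: "x \<notin> S" "y \<notin> S" and cards: "card P = k" "card Q = k"
        using S unfolding P_def Q_def by (auto simp: card_insert_if split: if_splits)
      have fin: "finite P" "finite Q" using S unfolding P_def Q_def by auto
      have "k \<le> card T" if "finite T" "separates r' A P T" for T
        using separates_if_separates_from_separator[OF sepP _ that(2)[unfolded r'_def]]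
          less.prems(4) that(1) unfolding P_def by auto
      with less.hyps[of r' A P] r' less.prems fin
      obtain Ps where Ps: "disjoint_dipaths r' A P Ps" "card Ps = k" by blast
      then have "card Ps = card P" using cards by simp
      with Ps(1) obtain p where
        p: "\<And>z. z \<in> P \<Longrightarrow> dipath r' (p z) \<and> hd (p z) \<in> A \<and> last (p z) = z" and
        pdisj: "\<And>z w. z \<in> P \<Longrightarrow> w \<in> P \<Longrightarrow> z \<noteq> w \<Longrightarrow> set (p z) \<inter> set (p w) = {}"
        by (rule disjoint_dipaths_onto_targets[OF _ _ fin(1)]) blast
      \<comment> \<open>The same argument for the reversed relation, where the deleted arc is
        \<open>(y, x)\<close> and \<open>y \<in> Q\<close>.\<close>
      have "k \<le> card T" if "finite T" "separates r' Q B T" for T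
      proof -
        have "separates (r\<inverse> - {(y, x)}) B Q T"
        proof -
          have "r\<inverse> - {(y, x)} = r'\<inverse>" unfolding r'_def by auto
          then show ?thesis using that(2) by (simp add: separates_converse)
        qed
        moreover have "separates (r\<inverse>) B A Q" using sepQ by (simp add: separates_converse)
        ultimately have "separates (r\<inverse>) B A T"
          using separates_if_separates_from_separator[of "r\<inverse>" B A Q y x T]
          unfolding Q_def by auto
        then show ?thesis using less.prems(4) that(1) by (simp add: separates_converse)
      qed
      with less.hyps[of r' Q B] r' less.prems fin
      obtain Qs where Qs: "disjoint_dipaths r' Q B Qs" "card Qs = k" by blast
      then have "card Qs = card Q" using cards by simp
      with Qs(1) obtain q where
        q: "\<And>z. z \<in> Q \<Longrightarrow> dipath r' (q z) \<and> last (q z) \<in> B \<and> hd (q z) = z" and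
        qdisj: "\<And>z w. z \<in> Q \<Longrightarrow> w \<in> Q \<Longrightarrow> z \<noteq> w \<Longrightarrow> set (q z) \<inter> set (q w) = {}"
        by (rule disjoint_dipaths_onto_sources[OF _ _ fin(2)]) blast
      have onP: "w = z" if "z \<in> P" "w \<in> P" "w \<in> set (p z)" for z w
      proof (rule ccontr)
        assume "w \<noteq> z"
        moreover have "w \<in> set (p w)" using p[OF that(2)] by (metis dipath_def last_in_set)
        ultimately show False using pdisj[of z w] that by auto
      qed
      have onQ: "w = z" if "z \<in> Q" "w \<in> Q" "w \<in> set (q z)" for z w
      proof (rule ccontr)
        assume "w \<noteq> z"
        moreover have "w \<in> set (q w)" using q[OF that(2)] by (metis dipath_def hd_in_set)
        ultimately show False using qdisj[of z w] that by auto
      qed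
      \<comment> \<open>A common vertex outside \<open>S\<close> would join an initial segment of
        one path to a final segment of the other: a walk from \<open>A\<close> to \<open>B\<close>
        in \<open>r'\<close> that avoids \<open>S\<close>.\<close>
      have meet: "w \<in> S" if z: "z \<in> P" "z' \<in> Q" and w: "w \<in> set (p z)" "w \<in> set (q z')" for z z' w
      proof (rule ccontr)
        assume wS: "w \<notin> S"
        obtain xs ys where ps: "p z = xs @ w # ys" using split_list[OF w(1)] by blast
        obtain us vs where qs: "q z' = us @ w # vs" using split_list[OF w(2)] by blast
        note pz = p[OF z(1), unfolded dipath_def] and qz = q[OF z(2), unfolded dipath_def]
        have "set (xs @ [w]) \<inter> S = {}"
        proof (rule ccontr)
          assume "set (xs @ [w]) \<inter> S \<noteq> {}"
          then obtain s where s: "s \<in> S" "s \<in> set xs" using wS by auto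
          then have "s = z" using onP[of z s] z ps unfolding P_def by auto
          moreover have "z \<in> set (w # ys)" using pz unfolding ps by (auto split: if_splits)
          ultimately show False using s pz unfolding ps by auto
        qed
        moreover have "successively (\<lambda>u v. (u, v) \<in> r') (xs @ [w])"
          using pz unfolding ps by (auto simp: successively_append_iff)
        ultimately have 1: "(hd (p z), w) \<in> (r' \<inter> (- S) \<times> (- S))\<^sup>*"
          using successively_imp_rtrancl[of r' "xs @ [w]" S] unfolding ps
          by (auto simp: hd_append)
        have a: "hd (p z) \<notin> S"
          using \<open>set (xs @ [w]) \<inter> S = {}\<close> unfolding ps by (cases xs) auto
        have disj2: "set (w # vs) \<inter> S = {}"
        proof (rule ccontr)
          assume "set (w # vs) \<inter> S \<noteq> {}"
          then obtain s where s: "s \<in> S" "s \<in> set vs" using wS by auto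
          then have "s = z'" using onQ[of z' s] z qs unfolding Q_def by auto
          moreover have "z' \<in> set (us @ [w])" using qz unfolding qs by (cases us) auto
          ultimately show False using s qz unfolding qs by auto
        qed
        moreover have "successively (\<lambda>u v. (u, v) \<in> r') (w # vs)"
          using qz unfolding qs by (auto simp: successively_append_iff)
        ultimately have 2: "(w, last (q z')) \<in> (r' \<inter> (- S) \<times> (- S))\<^sup>*"
          using successively_imp_rtrancl[of r' "w # vs" S] unfolding qs by auto
        have b: "last (q z') \<notin> S"
        proof -
          have "last (q z') \<in> set (w # vs)" unfolding qs by auto
          then show ?thesis using disj2 by blast
        qed
        show False using S(2) rtrancl_trans[OF 1 2] a b pz qz unfolding separates_def by blast
      qed
      \<comment> \<open>The ends are matched by fixing \<open>S\<close> and sending \<open>x\<close>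
        to \<open>y\<close>. The deleted arc bridges the gap for \<open>z = x\<close>; for the other
        \<open>z\<close> the doubled vertex is dropped by \<open>tl\<close>.\<close>
      define \<sigma> where "\<sigma> z = (if z = x then y else z)" for z
      have \<sigma>: "\<sigma> z \<in> Q" if "z \<in> P" for z using that unfolding \<sigma>_def P_def Q_def by auto
      define h where "h z = p z @ (if z = x then q y else tl (q z))" for z
      have seth: "set (h z) \<subseteq> set (p z) \<union> set (q (\<sigma> z))" for z
        unfolding h_def \<sigma>_def by (cases "q z") auto
      have common: "w = z \<and> z = z' \<and> z \<in> S"
        if "z \<in> P" "z' \<in> P" "w \<in> set (p z)" "w \<in> set (q (\<sigma> z'))" for z z' w
      proof -
        have "w \<in> S" using meet that \<sigma> by blast
        then have "w = z" "w = \<sigma> z'"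
          using onP[of z w] onQ[of "\<sigma> z'" w] that \<sigma> unfolding P_def Q_def by auto
        then show ?thesis using \<open>w \<in> S\<close> nS unfolding \<sigma>_def by (auto split: if_splits)
      qed
      have hpath: "dipath r (h z) \<and> hd (h z) \<in> A \<and> last (h z) \<in> B" if z: "z \<in> P" for z
      proof -
        have pz: "p z \<noteq> []" "distinct (p z)" "successively (\<lambda>u v. (u, v) \<in> r) (p z)"
          "hd (p z) \<in> A" "last (p z) = z"
          using p[OF z] dipath_mono[OF _ r'(1)] unfolding dipath_def by auto
        have qz: "q (\<sigma> z) \<noteq> []" "distinct (q (\<sigma> z))" "successively (\<lambda>u v. (u, v) \<in> r) (q (\<sigma> z))"
          "last (q (\<sigma> z)) \<in> B" "hd (q (\<sigma> z)) = \<sigma> z"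
          using q[OF \<sigma>[OF z]] dipath_mono[OF _ r'(1)] unfolding dipath_def by auto
        show ?thesis
        proof (cases "z = x")
          case True
          then have "set (p z) \<inter> set (q (\<sigma> z)) = {}" using common[of z z] z nS by auto
          then show ?thesis using pz qz xy True
            unfolding h_def dipath_def \<sigma>_def by (auto simp: successively_append_iff)
        next
          case False
          then have "\<sigma> z = z" unfolding \<sigma>_def by auto
          then obtain l where l: "q z = z # l" using qz by (cases "q z") auto
          have "set (p z) \<inter> set l = {}"
            using common[of z z] z l qz \<open>\<sigma> z = z\<close> by fastforce
          then show ?thesis using pz qz False l \<open>\<sigma> z = z\<close>
            unfolding h_def dipath_def
            by (auto simp: successively_append_iff successively_Cons split: if_splits)
        qed
      qed
      have hdisj: "set (h z) \<inter> set (h z') = {}" if "z \<in> P" "z' \<in> P" "z \<noteq> z'" for z z'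
      proof -
        have "\<sigma> z \<noteq> \<sigma> z'" using that nS unfolding \<sigma>_def P_def by auto
        then have "set (q (\<sigma> z)) \<inter> set (q (\<sigma> z')) = {}" using qdisj \<sigma> that by auto
        moreover have "set (p z) \<inter> set (p z') = {}" using pdisj that by auto
        moreover have "set (p z) \<inter> set (q (\<sigma> z')) = {}" "set (p z') \<inter> set (q (\<sigma> z)) = {}"
          using common that by blast+
        ultimately show ?thesis using seth[of z] seth[of z'] by blast
      qed
      have "inj_on h P"
      proof (rule inj_onI, rule ccontr)
        fix z z' assume zz: "z \<in> P" "z' \<in> P" "h z = h z'" "z \<noteq> z'"
        then have "set (h z) = {}" using hdisj[of z z'] by auto
        then show False using hpath[OF zz(1)] unfolding dipath_def by auto
      qed
      then have "card (h ` P) = k" using cards by (simp add: card_image)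
      moreover have "disjoint_dipaths r A B (h ` P)"
        using hpath hdisj fin unfolding disjoint_dipaths_def by blast
      ultimately show ?thesis by blast
    qed
  qed
qed

section \<open>Internally disjoint paths between two vertices of an undirected graph\<close>

lemma path_edges_Cons_Cons: "path_edges (a # b # p) = insert {a, b} (path_edges (b # p))"
  by (simp add: path_edges_def)

lemma path_edges_trivial [simp]: "path_edges [] = {}" "path_edges [a] = {}"
  by (simp_all add: path_edges_def)

lemma path_edges_subset_iff: "path_edges p \<subseteq> F \<longleftrightarrow> successively (\<lambda>u v. {u, v} \<in> F) p"
  by (induction p rule: induct_list012) (simp_all add: path_edges_Cons_Cons)

lemma in_path_edges_iff: "e \<in> path_edges p \<longleftrightarrow> (\<exists>xs a b ys. p = xs @ a # b # ys \<and> e = {a, b})"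
proof (induction p rule: induct_list012)
  case (3 x y zs)
  have "e \<in> path_edges (x # y # zs) \<longleftrightarrow> e = {x, y} \<or> (\<exists>xs a b ys. y # zs = xs @ a # b # ys \<and> e = {a, b})"
    using 3 by (simp add: path_edges_Cons_Cons)
  also have "\<dots> \<longleftrightarrow> (\<exists>xs a b ys. x # y # zs = xs @ a # b # ys \<and> e = {a, b})"
    (is "?l \<longleftrightarrow> (\<exists>xs. ?r xs)")
  proof
    assume ?l
    then show "\<exists>xs. ?r xs"
    proof
      assume "e = {x, y}"
      then have "?r []" by auto
      then show ?thesis ..
    next
      assume "\<exists>xs a b ys. y # zs = xs @ a # b # ys \<and> e = {a, b}"
      then obtain xs a b ys where "y # zs = xs @ a # b # ys" "e = {a, b}" by blast
      then have "?r (x # xs)" by auto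
      then show ?thesis ..
    qed
  next
    assume "\<exists>xs. ?r xs"
    then obtain xs a b ys where *: "x # y # zs = xs @ a # b # ys" "e = {a, b}" by blast
    then show ?l by (cases xs) auto
  qed
  finally show ?case .
qed auto

lemma card_gt_imp_ex_not_in:
  assumes "finite T" "card T < card V"
  shows "\<exists>z\<in>V. z \<notin> T"
  using assms by (metis card_mono not_le subsetI)

text \<open>The set version is applied inside \<open>V - {x, y}\<close> to the neighbours of
  \<open>x\<close> and the neighbours of \<open>y\<close>; the ends are then attached again.\<close>

theorem Menger_vertices:
  assumes kc: "k_connected k V F" and xy: "x \<in> V" "y \<in> V" "x \<noteq> y" and k: "k \<ge> 1"
  shows "\<exists>Ps. finite Ps \<and> card Ps = k \<and>
     (\<forall>P\<in>Ps. is_path F P \<and> hd P = x \<and> last P = y) \<and>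
     (\<forall>P\<in>Ps. \<forall>Q\<in>Ps. P \<noteq> Q \<longrightarrow> inner_vertices P \<inter> inner_vertices Q = {})"
proof -
  have finV: "finite V" and cardV: "card V \<ge> k + 1"
    and conn: "\<And>S. S \<subseteq> V \<Longrightarrow> card S \<le> k - 1 \<Longrightarrow> connected_on F (V - S)"
    using kc unfolding k_connected_def simple_graph_def by auto
  define U where "U = V - {x, y}"
  define r where "r = {(a, b). a \<in> U \<and> b \<in> U \<and> {a, b} \<in> F}"
  define A where "A = {a \<in> U. {x, a} \<in> F}"
  define B where "B = {b \<in> U. {b, y} \<in> F}"
  \<comment> \<open>If \<open>{x, y}\<close> is an edge, it serves as one of the paths itself, so
    one path fewer is needed from the set version.\<close>
  define j where "j = (if {x, y} \<in> F then k - 1 else k)"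
  have "finite U" using finV unfolding U_def by auto
  then have fin: "finite A" "finite B" "finite r"
  proof -
    have "r \<subseteq> U \<times> U" unfolding r_def by auto
    then show "finite r" using \<open>finite U\<close> finite_subset by blast
  qed (use \<open>finite U\<close> in \<open>auto simp: A_def B_def\<close>)
  have reach: "(hd q, last q) \<in> (r \<inter> (- S) \<times> (- S))\<^sup>*"
    if "path_edges q \<subseteq> F" "q \<noteq> []" "set q \<subseteq> U" "set q \<inter> S = {}" for q S
  proof (rule successively_imp_rtrancl)
    show "successively (\<lambda>u v. (u, v) \<in> r) q"
      using that(1) unfolding path_edges_subset_iff
      by (rule successively_mono) (use that(3) in \<open>auto simp: r_def\<close>)
  qed (use that in auto)
  have "j \<le> card S" if S: "finite S" "separates r A B S" for S
  proof (rule ccontr)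
    assume less: "\<not> j \<le> card S"
    \<comment> \<open>\<open>S\<close> is arbitrary and may contain vertices outside
      \<open>U\<close>, such as \<open>x\<close>; only its part in \<open>U\<close> is deleted from
      the graph.\<close>
    define S' where "S' = S \<inter> U"
    have S': "S' \<subseteq> V" "finite S'" "x \<notin> S'" "y \<notin> S'" unfolding S'_def U_def using S by auto
    have cS': "card S' \<le> card S" unfolding S'_def using S(1) by (simp add: card_mono)
    have notS: "set q \<inter> S = {}" if "set q \<subseteq> U" "set q \<inter> S' = {}" for q
      using that unfolding S'_def by auto
    have False if a: "a \<in> A" "a \<notin> S'" and b: "b \<in> B" "b \<notin> S'"
      and ab: "(a, b) \<in> (r \<inter> (- S) \<times> (- S))\<^sup>*" for a b
      using S(2) that unfolding separates_def S'_def A_def B_def by blast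
    note contra = this
    show False
    proof (cases "{x, y} \<in> F")
      case False
      then have "card S' \<le> k - 1" using less cS' unfolding j_def by auto
      from conn[OF S'(1) this] obtain P where P: "is_path F P" "hd P = x" "last P = y" "set P \<subseteq> V - S'"
        using xy S' unfolding connected_on_def by blast
      obtain q where q: "P = x # q @ [y]"
      proof -
        obtain P1 where P1: "P = x # P1" using P unfolding is_path_def by (cases P) auto
        then have "P1 \<noteq> []" using P xy by auto
        then show thesis using that[of "butlast P1"] P1 P by auto
      qed
      have pe: "successively (\<lambda>u v. {u, v} \<in> F) (x # q @ [y])"
        using P(1) unfolding is_path_def path_edges_subset_iff q by auto
      have "q \<noteq> []" using pe False by auto
      have qU: "set q \<subseteq> U" "set q \<inter> S' = {}"
        using P unfolding is_path_def q U_def by auto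
      have "path_edges q \<subseteq> F"
        using pe unfolding path_edges_subset_iff by (auto simp: successively_append_iff successively_Cons)
      then have "(hd q, last q) \<in> (r \<inter> (- S) \<times> (- S))\<^sup>*"
        using reach[of q S] notS qU \<open>q \<noteq> []\<close> by auto
      moreover have "{x, hd q} \<in> F" "{last q, y} \<in> F"
        using pe \<open>q \<noteq> []\<close> by (auto simp: successively_append_iff successively_Cons)
      moreover have "hd q \<in> U - S'" "last q \<in> U - S'"
        using qU hd_in_set[OF \<open>q \<noteq> []\<close>] last_in_set[OF \<open>q \<noteq> []\<close>] by blast+
      ultimately show False using contra[of "hd q" "last q"] unfolding A_def B_def by auto
    next
      case True
      \<comment> \<open>Connectedness could return the edge \<open>{x, y}\<close> itself, so the
        walk is led through a third vertex \<open>z\<close>: \<open>y\<close> is deleted for the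
        first half and \<open>x\<close> for the second, together with \<open>S'\<close> at most
        \<open>k - 1\<close> vertices each time.\<close>
      then have c: "card S' + 2 \<le> k" using less cS' unfolding j_def by auto
      have "card (S' \<union> {x, y}) < card V"
      proof -
        have "card (S' \<union> {x, y}) = card S' + 2" using S' xy by auto
        then show ?thesis using c cardV by simp
      qed
      then obtain z where z: "z \<in> V" "z \<notin> S' \<union> {x, y}"
        using card_gt_imp_ex_not_in[of "S' \<union> {x, y}" V] S' by auto
      have "connected_on F (V - insert y S')" using conn[of "insert y S'"] S' xy c by auto
      then obtain P1 where P1: "is_path F P1" "hd P1 = x" "last P1 = z" "set P1 \<subseteq> V - insert y S'"
        using xy z S' unfolding connected_on_def by blast
      then obtain q1 where q1: "P1 = x # q1" unfolding is_path_def by (cases P1) auto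
      then have "q1 \<noteq> []" using P1 z by auto
      have q1U: "set q1 \<subseteq> U" "set q1 \<inter> S' = {}"
        using P1 unfolding is_path_def q1 U_def by auto
      have p1: "successively (\<lambda>u v. {u, v} \<in> F) (x # q1)"
        using P1(1) unfolding is_path_def path_edges_subset_iff q1 by auto
      then have "path_edges q1 \<subseteq> F"
        unfolding path_edges_subset_iff by (auto simp: successively_Cons)
      then have r1: "(hd q1, z) \<in> (r \<inter> (- S) \<times> (- S))\<^sup>*"
        using reach[of q1 S] notS q1U \<open>q1 \<noteq> []\<close> P1 q1 by auto
      have a: "{x, hd q1} \<in> F" using p1 \<open>q1 \<noteq> []\<close> by (auto simp: successively_Cons)
      have "connected_on F (V - insert x S')" using conn[of "insert x S'"] S' xy c by auto
      then obtain P2 where P2: "is_path F P2" "hd P2 = z" "last P2 = y" "set P2 \<subseteq> V - insert x S'"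
        using xy z S' unfolding connected_on_def by blast
      then obtain q2 where q2: "P2 = q2 @ [y]" unfolding is_path_def
        by (metis append_butlast_last_id)
      then have "q2 \<noteq> []" using P2 z by auto
      have q2U: "set q2 \<subseteq> U" "set q2 \<inter> S' = {}"
        using P2 unfolding is_path_def q2 U_def by auto
      have p2: "successively (\<lambda>u v. {u, v} \<in> F) (q2 @ [y])"
        using P2(1) unfolding is_path_def path_edges_subset_iff q2 by auto
      then have "path_edges q2 \<subseteq> F"
        unfolding path_edges_subset_iff by (auto simp: successively_append_iff)
      then have r2: "(z, last q2) \<in> (r \<inter> (- S) \<times> (- S))\<^sup>*"
        using reach[of q2 S] notS q2U \<open>q2 \<noteq> []\<close> P2 q2 by auto
      have b: "{last q2, y} \<in> F" using p2 \<open>q2 \<noteq> []\<close> by (auto simp: successively_append_iff)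
      moreover have "hd q1 \<in> U - S'" "last q2 \<in> U - S'"
        using q1U q2U hd_in_set[OF \<open>q1 \<noteq> []\<close>] last_in_set[OF \<open>q2 \<noteq> []\<close>] by blast+
      ultimately show False
        using contra[OF _ _ _ _ rtrancl_trans[OF r1 r2]] a unfolding A_def B_def by auto
    qed
  qed
  then obtain Qs where Qs: "disjoint_dipaths r A B Qs" "card Qs = j"
    using Menger_sets[OF fin(3) fin(1) fin(2)] by blast
  define g where "g q = x # q @ [y]" for q
  have inU: "set q \<subseteq> U" if "q \<in> Qs" for q
  proof
    fix w assume "w \<in> set q"
    then obtain us vs where q: "q = us @ w # vs" using split_list by metis
    have q': "successively (\<lambda>u v. (u, v) \<in> r) q" "hd q \<in> A"
      using Qs that unfolding disjoint_dipaths_def dipath_def by auto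
    show "w \<in> U"
    proof (cases us rule: rev_cases)
      case Nil
      then show ?thesis using q q' unfolding A_def by auto
    next
      case (snoc us' u)
      then have "(u, w) \<in> r" using q q' by (auto simp: successively_append_iff)
      then show ?thesis unfolding r_def by auto
    qed
  qed
  have gp: "is_path F (g q) \<and> hd (g q) = x \<and> last (g q) = y \<and> inner_vertices (g q) = set q"
    if "q \<in> Qs" for q
  proof -
    have q: "q \<noteq> []" "distinct q" "successively (\<lambda>u v. (u, v) \<in> r) q" "hd q \<in> A" "last q \<in> B"
      using Qs that unfolding disjoint_dipaths_def dipath_def by auto
    have "successively (\<lambda>u v. {u, v} \<in> F) q"
      using q(3) by (rule successively_mono) (auto simp: r_def)
    then have "successively (\<lambda>u v. {u, v} \<in> F) (g q)"
      using q unfolding g_def A_def B_def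
      by (auto simp: successively_append_iff successively_Cons)
    moreover have "distinct (g q)" using q inU[OF that] xy unfolding g_def U_def by auto
    ultimately show ?thesis
      unfolding is_path_def path_edges_subset_iff inner_vertices_def by (auto simp: g_def)
  qed
  have injg: "inj_on g Qs" unfolding g_def by (auto simp: inj_on_def)
  have finQ: "finite Qs" using Qs unfolding disjoint_dipaths_def by auto
  have disj: "inner_vertices P \<inter> inner_vertices Q = {}"
    if PQ: "P \<in> g ` Qs" "Q \<in> g ` Qs" "P \<noteq> Q" for P Q
  proof -
    obtain p q where "P = g p" "Q = g q" "p \<in> Qs" "q \<in> Qs" "p \<noteq> q" using PQ by blast
    then show ?thesis using gp Qs(1) unfolding disjoint_dipaths_def by simp
  qed
  show ?thesis
  proof (cases "{x, y} \<in> F")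
    case False
    then have "card (g ` Qs) = k" using Qs injg unfolding j_def by (simp add: card_image)
    then show ?thesis using finQ gp disj by (intro exI[of _ "g ` Qs"]) blast
  next
    case True
    have "[x, y] \<notin> g ` Qs"
      using Qs unfolding g_def disjoint_dipaths_def dipath_def by auto
    then have "card (insert [x, y] (g ` Qs)) = k"
      using Qs injg True finQ k unfolding j_def by (simp add: card_image)
    moreover have "is_path F [x, y]" "inner_vertices [x, y] = {}"
      using xy True by (auto simp: is_path_def path_edges_def inner_vertices_def)
    moreover from this have "\<forall>P\<in>insert [x, y] (g ` Qs). \<forall>Q\<in>insert [x, y] (g ` Qs).
        P \<noteq> Q \<longrightarrow> inner_vertices P \<inter> inner_vertices Q = {}"
      using disj by blast
    ultimately show ?thesis using finQ gp
      by (intro exI[of _ "insert [x, y] (g ` Qs)"]) simp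
  qed
qed

section \<open>Lower bound: one colour on a spanning k-connected subgraph\<close>

lemma is_path_mono: "is_path F P \<Longrightarrow> F \<subseteq> E \<Longrightarrow> is_path E P"
  unfolding is_path_def by auto

lemma mono_k_connected_colouring_if_constant_on:
  assumes "k_connected k V F" "F \<subseteq> E" "k \<ge> 1" and c: "\<And>e. e \<in> F \<Longrightarrow> c e = c0"
  shows "mono_k_connected_colouring k V E c"
  unfolding mono_k_connected_colouring_def
proof (intro ballI impI)
  fix x y assume "x \<in> V" "y \<in> V" "x \<noteq> y"
  from Menger_vertices[OF assms(1) this assms(3)]
  obtain Ps where Ps: "finite Ps" "card Ps = k"
    "\<forall>P\<in>Ps. is_path F P \<and> hd P = x \<and> last P = y"
    "\<forall>P\<in>Ps. \<forall>Q\<in>Ps. P \<noteq> Q \<longrightarrow> inner_vertices P \<inter> inner_vertices Q = {}" by blast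
  have "monochromatic c P" if "P \<in> Ps" for P
    using Ps(3) that c unfolding monochromatic_def is_path_def by blast
  then show "k_mono_linked k E c x y"
    unfolding k_mono_linked_def using Ps is_path_mono[OF _ assms(2)]
    by (intro exI[of _ Ps]) auto
qed

lemma ex_colouring_constant_on:
  assumes "finite E" "F \<subseteq> E" "F \<noteq> {}"
  obtains c :: "'b \<Rightarrow> nat" where "\<And>e. e \<in> F \<Longrightarrow> c e = 0" "card (c ` E) = card E - card F + 1"
proof -
  obtain f :: "'b \<Rightarrow> nat" where f: "inj_on f E"
    using assms(1) finite_imp_inj_to_nat_seg by blast
  \<comment> \<open>Colour 0 is reserved for \<open>F\<close>; \<open>Suc\<close> keeps the pairwise
    different colours of the remaining edges away from it.\<close>
  define c where "c e = (if e \<in> F then 0 else Suc (f e))" for e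
  have "c ` E = insert 0 (c ` (E - F))" using assms unfolding c_def by auto
  moreover have "0 \<notin> c ` (E - F)" unfolding c_def by auto
  moreover have "inj_on c (E - F)" using f unfolding c_def inj_on_def by auto
  ultimately have "card (c ` E) = card (E - F) + 1" using assms(1) by (simp add: card_image)
  also have "card (E - F) = card E - card F"
    using assms by (meson card_Diff_subset finite_subset)
  finally show thesis using that[of c] unfolding c_def by auto
qed

section \<open>Colourings of bipartite graphs\<close>

text \<open>Connectedness of the graph formed by the edges in \<open>C\<close>, stated without
  walks: to identify a subset with the whole class, only the edges that meet it have to be checked.
  The empty set counts as connected.\<close>

definition edge_connected :: "'a set set \<Rightarrow> bool" where
  "edge_connected C \<longleftrightarrow>
     (\<forall>D\<subseteq>C. D \<noteq> {} \<longrightarrow> (\<forall>e\<in>D. \<forall>f\<in>C. e \<inter> f \<noteq> {} \<longrightarrow> f \<in> D) \<longrightarrow> D = C)"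

lemma edge_connectedD:
  assumes "edge_connected C" "D \<subseteq> C" "D \<noteq> {}"
    and "\<And>e f. e \<in> D \<Longrightarrow> f \<in> C \<Longrightarrow> e \<inter> f \<noteq> {} \<Longrightarrow> f \<in> D"
  shows "D = C"
  using assms unfolding edge_connected_def by meson

text \<open>Edges are added one at a time, each meeting an earlier one, so every edge after the
  first brings at most one new vertex.\<close>

lemma card_Union_edge_connected:
  assumes "edge_connected C" "finite C" "C \<noteq> {}" and two: "\<And>e. e \<in> C \<Longrightarrow> finite e \<and> card e = 2"
  shows "card (\<Union>C) \<le> card C + 1"
proof -
  have "\<exists>D\<subseteq>C. card D = Suc n \<and> card (\<Union>D) \<le> Suc n + 1" if "Suc n \<le> card C" for n
    using that
  proof (induction n)
    case 0
    obtain e where "e \<in> C" using assms(3) by auto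
    then show ?case using two[of e] by (intro exI[of _ "{e}"]) auto
  next
    case (Suc n)
    then obtain D where D: "D \<subseteq> C" "card D = Suc n" "card (\<Union>D) \<le> Suc n + 1" by auto
    then have "D \<noteq> C" "D \<noteq> {}" using Suc.prems by auto
    then obtain e f where ef: "e \<in> D" "f \<in> C" "e \<inter> f \<noteq> {}" "f \<notin> D"
      using assms(1) D(1) unfolding edge_connected_def by meson
    have finD: "finite D" "finite (\<Union>D)"
      using D(1) assms(2) two finite_subset by (blast, metis finite_Union finite_subset subsetD)
    obtain w where w: "w \<in> e" "w \<in> f" using ef(3) by auto
    have "\<Union>(insert f D) = \<Union>D \<union> (f - {w})" using w ef(1) by auto
    then have "card (\<Union>(insert f D)) \<le> card (\<Union>D) + card (f - {w})"
      by (simp add: card_Un_le)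
    also have "\<dots> \<le> Suc (Suc n) + 1" using D(3) two[OF ef(2)] w by (simp add: card_Diff_singleton)
    finally show ?case using D(1,2) ef finD(1) by (intro exI[of _ "insert f D"]) auto
  qed
  moreover have "Suc (card C - 1) = card C" using assms(2,3) by (simp add: card_gt_0_iff)
  ultimately obtain D where "D \<subseteq> C" "card D = card C" "card (\<Union>D) \<le> card C + 1"
    by (metis order_refl)
  then show ?thesis using assms(2) by (metis card_subset_eq)
qed

text \<open>Splitting every colour into its connected components keeps all monochromatic paths.\<close>
lemma ex_edge_connected_colouring:
  fixes E :: "'a set set" and c :: "'a set \<Rightarrow> 'c"
  assumes fin: "finite E" and mono: "mono_k_connected_colouring k V E c"
  obtains c' :: "'a set \<Rightarrow> 'a set set" where "mono_k_connected_colouring k V E c'"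
    and "\<And>i. edge_connected {e \<in> E. c' e = i}" and "card (c ` E) \<le> card (c' ` E)"
proof -
  define R where "R = {(e, f). e \<in> E \<and> f \<in> E \<and> c e = c f \<and> e \<inter> f \<noteq> {}}"
  \<comment> \<open>A component serves as the name of its own colour, so the new colours are sets of
    edges.\<close>
  define c' where "c' e = R\<^sup>* `` {e}" for e
  have "sym R" unfolding R_def sym_def by auto
  then have symR: "sym (R\<^sup>*)" by (rule sym_rtrancl)
  have c'_eq: "c' e = c' f \<longleftrightarrow> (e, f) \<in> R\<^sup>*" for e f
    using symR unfolding c'_def by (auto dest: symD rtrancl_trans)
  have c_eq: "c e = c f" if "(e, f) \<in> R\<^sup>*" for e f
    using that by (induction rule: rtrancl_induct) (auto simp: R_def)
  \<comment> \<open>Consecutive edges of a monochromatic path share a vertex, so the whole path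
    stays in the component of its first edge.\<close>
  have path: "({x, y}, f) \<in> R\<^sup>*"
    if "path_edges (x # y # zs) \<subseteq> E" "\<forall>e\<in>path_edges (x # y # zs). c e = col"
      "f \<in> path_edges (x # y # zs)" for x y zs f col
    using that
  proof (induction zs arbitrary: x y)
    case Nil
    then show ?case by (auto simp: path_edges_Cons_Cons)
  next
    case (Cons z zs)
    have "({x, y}, {y, z}) \<in> R" using Cons.prems unfolding R_def by (auto simp: path_edges_Cons_Cons)
    moreover have "f = {x, y} \<or> ({y, z}, f) \<in> R\<^sup>*"
      using Cons.IH[of y z] Cons.prems by (auto simp: path_edges_Cons_Cons)
    ultimately show ?case by (auto intro: converse_rtrancl_into_rtrancl)
  qed
  have mono_path: "monochromatic c' P" if "is_path E P" "monochromatic c P" for P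
  proof (cases "\<exists>x y zs. P = x # y # zs")
    case True
    then obtain x y zs where P: "P = x # y # zs" by blast
    have "c' f = c' {x, y}" if "f \<in> path_edges P" for f
      using path[of x y zs _ f] that \<open>is_path E P\<close> \<open>monochromatic c P\<close> c'_eq
      unfolding P is_path_def monochromatic_def by metis
    then show ?thesis unfolding monochromatic_def by blast
  next
    case False
    then have "path_edges P = {}" by (cases P rule: remdups_adj.cases) auto
    then show ?thesis unfolding monochromatic_def by auto
  qed
  have "k_mono_linked k E c' x y" if xy: "k_mono_linked k E c x y" for x y
  proof -
    obtain Ps where "finite Ps" "card Ps = k"
      "\<forall>P\<in>Ps. is_path E P \<and> hd P = x \<and> last P = y \<and> monochromatic c P"
      "\<forall>P\<in>Ps. \<forall>Q\<in>Ps. P \<noteq> Q \<longrightarrow> inner_vertices P \<inter> inner_vertices Q = {}"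
      using xy unfolding k_mono_linked_def by blast
    then show ?thesis unfolding k_mono_linked_def using mono_path by (intro exI[of _ Ps]) auto
  qed
  then have 1: "mono_k_connected_colouring k V E c'"
    using mono unfolding mono_k_connected_colouring_def by blast
  have 2: "edge_connected {e \<in> E. c' e = i}" for i
    unfolding edge_connected_def
  proof (intro allI impI)
    fix D assume D: "D \<subseteq> {e \<in> E. c' e = i}" "D \<noteq> {}"
      and closed: "\<forall>e\<in>D. \<forall>f\<in>{e \<in> E. c' e = i}. e \<inter> f \<noteq> {} \<longrightarrow> f \<in> D"
    obtain g where g: "g \<in> D" using D by auto
    have "f \<in> D" if "(g, f) \<in> R\<^sup>*" for f
      using that
    proof (induction rule: rtrancl_induct)
      case (step e f)
      then have "c' f = c' e" using c'_eq[of e f] by auto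
      then have "f \<in> {e \<in> E. c' e = i}" using step D unfolding R_def by auto
      then show ?case using closed step unfolding R_def by blast
    qed (use g in auto)
    moreover have "(g, f) \<in> R\<^sup>*" if "f \<in> {e \<in> E. c' e = i}" for f
      using that g D c'_eq[of g f] by auto
    ultimately show "D = {e \<in> E. c' e = i}" using D by auto
  qed
  \<comment> \<open>A component determines the old colour of its edges through any representative,
    so splitting cannot reduce the number of colours.\<close>
  have "c e = c (SOME f. f \<in> c' e)" for e
  proof -
    have "e \<in> c' e" unfolding c'_def by auto
    then have "(SOME f. f \<in> c' e) \<in> c' e" by (rule someI)
    then show ?thesis using c_eq unfolding c'_def by auto
  qed
  then have "c ` E = (\<lambda>X. c (SOME f. f \<in> X)) ` c' ` E" by (simp add: image_image)
  then have "card (c ` E) \<le> card (c' ` E)" using fin by (simp add: card_image_le)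
  with 1 2 show thesis by (rule that)
qed

section \<open>Sums of minima over ordered pairs\<close>

lemma sum_min_offdiag_le:
  fixes f :: "'b \<Rightarrow> nat"
  assumes "finite S"
  shows "(\<Sum>u\<in>S. \<Sum>v\<in>S - {u}. min (f u) (f v)) \<le> (card S - 1) * sum f S"
proof -
  have "(\<Sum>u\<in>S. \<Sum>v\<in>S - {u}. min (f u) (f v)) + sum f S \<le> (\<Sum>u\<in>S. (\<Sum>v\<in>S - {u}. f v) + f u)"
    unfolding sum.distrib by (intro add_right_mono sum_mono) auto
  also have "\<dots> = (\<Sum>u\<in>S. sum f S)"
    by (intro sum.cong) (use assms in \<open>auto simp: sum.remove\<close>)
  also have "\<dots> = card S * sum f S" by simp
  finally show ?thesis by (simp add: diff_mult_distrib)
qed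

text \<open>The row of \<open>w\<close> contributes at most \<open>card S - 1\<close>. Every other
  row \<open>u\<close> contributes at most \<open>sum f S - f u\<close>, and these bounds add up to
  \<open>(card S - 2) * sum f S + f w\<close>.\<close>

lemma sum_min_offdiag_le_if_small_weight:
  fixes f :: "'b \<Rightarrow> nat"
  assumes "finite S" "2 \<le> card S" "w \<in> S" "f w \<le> 1"
  shows "(\<Sum>u\<in>S. \<Sum>v\<in>S - {u}. min (f u) (f v)) \<le> (card S - 2) * sum f S + card S"
proof -
  have fin: "finite (S - {w})" and c: "card (S - {w}) = card S - 1" using assms by auto
  have row: "(\<Sum>v\<in>S - {w}. min (f w) (f v)) \<le> card S - 1"
  proof -
    have "(\<Sum>v\<in>S - {w}. min (f w) (f v)) \<le> (\<Sum>v\<in>S - {w}. 1)"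
      by (intro sum_mono) (use assms in auto)
    then show ?thesis using c by simp
  qed
  have "(\<Sum>u\<in>S - {w}. \<Sum>v\<in>S - {u}. min (f u) (f v)) + sum f (S - {w})
      \<le> (\<Sum>u\<in>S - {w}. (\<Sum>v\<in>S - {u}. f v) + f u)"
    unfolding sum.distrib by (intro add_right_mono sum_mono) auto
  also have "\<dots> = (\<Sum>u\<in>S - {w}. sum f S)"
  proof (intro sum.cong refl)
    fix u assume "u \<in> S - {w}"
    then show "(\<Sum>v\<in>S - {u}. f v) + f u = sum f S"
      using sum.remove[OF assms(1), of u f] by simp
  qed
  also have "\<dots> = (card S - 1) * sum f S" using c by simp
  also have "\<dots> = (card S - 2) * sum f S + sum f S"
    using assms(2) by (cases "card S") (auto simp: Suc_diff_le algebra_simps numeral_2_eq_2 split: nat_diff_split)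
  finally have "(\<Sum>u\<in>S - {w}. \<Sum>v\<in>S - {u}. min (f u) (f v)) + sum f (S - {w})
      \<le> (card S - 2) * sum f S + sum f S" .
  moreover have "sum f S = f w + sum f (S - {w})" using assms by (simp add: sum.remove)
  ultimately have "(\<Sum>u\<in>S - {w}. \<Sum>v\<in>S - {u}. min (f u) (f v)) \<le> (card S - 2) * sum f S + 1"
    using assms(4) by linarith
  moreover have "(\<Sum>u\<in>S. \<Sum>v\<in>S - {u}. min (f u) (f v)) =
      (\<Sum>v\<in>S - {w}. min (f w) (f v)) + (\<Sum>u\<in>S - {w}. \<Sum>v\<in>S - {u}. min (f u) (f v))"
    using assms by (simp add: sum.remove[of S w])
  ultimately show ?thesis using row assms(2) by linarith
qed

lemma sum_offdiag_support:
  fixes f :: "'b \<Rightarrow> nat"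
  assumes "finite S" "S' = {u \<in> S. f u > 0}"
  shows "(\<Sum>u\<in>S. \<Sum>v\<in>S - {u}. min (f u) (f v)) = (\<Sum>u\<in>S'. \<Sum>v\<in>S' - {u}. min (f u) (f v))"
proof -
  have "(\<Sum>u\<in>S. \<Sum>v\<in>S - {u}. min (f u) (f v)) = (\<Sum>u\<in>S'. \<Sum>v\<in>S - {u}. min (f u) (f v))"
    by (rule sum.mono_neutral_right) (use assms in auto)
  also have "\<dots> = (\<Sum>u\<in>S'. \<Sum>v\<in>S' - {u}. min (f u) (f v))"
    by (intro sum.cong refl sum.mono_neutral_right) (use assms in auto)
  finally show ?thesis .
qed

section \<open>Colour degrees and linking paths in a bipartite graph\<close>

locale bipartite_mono_colouring =
  fixes A B :: "'a set" and E :: "'a set set" and c :: "'a set \<Rightarrow> 'c" and k :: nat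
  assumes finite_A: "finite A" and finite_B: "finite B" and disjoint: "A \<inter> B = {}"
    and edges: "e \<in> E \<Longrightarrow> \<exists>a\<in>A. \<exists>b\<in>B. e = {a, b}"
    and linked: "x \<in> A \<union> B \<Longrightarrow> y \<in> A \<union> B \<Longrightarrow> x \<noteq> y \<Longrightarrow> k_mono_linked k E c x y"
    and connected: "edge_connected {e \<in> E. c e = i}"
begin

definition cls :: "'c \<Rightarrow> 'a set set" where "cls i = {e \<in> E. c e = i}"

text \<open>These colours carry the whole waste and all paths between vertices of one class: a
  colour with a single edge wastes nothing, and such a path has at least two edges.\<close>

definition big :: "'c set" where "big = {i \<in> c ` E. 2 \<le> card (cls i)}"

definition deg :: "'c \<Rightarrow> 'a \<Rightarrow> nat" where "deg i v = card {e \<in> cls i. v \<in> e}"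

text \<open>Bounds are proved for the class \<open>B\<close> only; exchanging the classes transfers
  them to \<open>A\<close>.\<close>

lemma swap: "bipartite_mono_colouring B A E c k"
proof
  fix e assume "e \<in> E"
  then show "\<exists>a\<in>B. \<exists>b\<in>A. e = {a, b}" using edges by (metis insert_commute)
qed (use finite_A finite_B disjoint linked connected in auto)

lemma finite_E: "finite E"
proof (rule finite_subset)
  show "E \<subseteq> (\<lambda>(a, b). {a, b}) ` (A \<times> B)" using edges by fastforce
qed (use finite_A finite_B in auto)

lemma finite_cls: "finite (cls i)" and finite_big: "finite big"
  using finite_E unfolding cls_def big_def by auto

lemma connected_cls: "edge_connected (cls i)"
  using connected unfolding cls_def .

lemma edge_at_B:
  assumes "e \<in> E" "b \<in> B" "b \<in> e"
  shows "\<exists>a\<in>A. e = {a, b}"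
  using edges[OF assms(1)] assms disjoint by auto

lemma sum_deg: "(\<Sum>v\<in>B. deg i v) = card (cls i)"
proof -
  have "cls i = (\<Union>v\<in>B. {e \<in> cls i. v \<in> e})" using edges unfolding cls_def by fastforce
  also have "card \<dots> = (\<Sum>v\<in>B. card {e \<in> cls i. v \<in> e})"
  proof (rule card_UN_disjoint)
    show "\<forall>u\<in>B. \<forall>v\<in>B. u \<noteq> v \<longrightarrow> {e \<in> cls i. u \<in> e} \<inter> {e \<in> cls i. v \<in> e} = {}"
      using edge_at_B disjoint unfolding cls_def by fastforce
  qed (use finite_B finite_cls in auto)
  finally show ?thesis unfolding deg_def ..
qed

text \<open>Colours outside \<open>big\<close> have exactly one edge, so edges minus colours equals
  the waste of the big colours. The additive form avoids truncated subtraction.\<close>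

lemma card_colours: "card E + card big = card (c ` E) + (\<Sum>i\<in>big. card (cls i))"
proof -
  have "card E = (\<Sum>i\<in>c ` E. card (cls i))"
    using sum.image_gen[OF finite_E, of "\<lambda>_. 1 :: nat" c] unfolding cls_def by simp
  also have "\<dots> = (\<Sum>i\<in>c ` E - big. card (cls i)) + (\<Sum>i\<in>big. card (cls i))"
    by (rule sum.subset_diff) (use finite_E in \<open>auto simp: big_def\<close>)
  also have "(\<Sum>i\<in>c ` E - big. card (cls i)) = (\<Sum>i\<in>c ` E - big. 1)"
  proof (rule sum.cong)
    fix i assume i: "i \<in> c ` E - big"
    then have "cls i \<noteq> {}" unfolding cls_def by auto
    then have "card (cls i) \<noteq> 0" using finite_cls by auto
    then show "card (cls i) = 1" using i unfolding big_def by auto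
  qed auto
  also have "\<dots> = card (c ` E) - card big"
    using finite_big by (simp add: card_Diff_subset big_def)
  finally show ?thesis
    using card_mono[of "c ` E" big] finite_E unfolding big_def by auto
qed

text \<open>Two vertices of one class are not adjacent, so each path has an inner vertex and at
  least two edges; its colour is therefore big.\<close>

lemma linking_paths:
  assumes u: "u \<in> B" and v: "v \<in> B" and "u \<noteq> v"
  obtains Ps where "finite Ps" "card Ps = k"
    and "\<And>P. P \<in> Ps \<Longrightarrow> \<exists>i\<in>big. is_path (cls i) P"
    and "\<And>P. P \<in> Ps \<Longrightarrow> \<exists>q. q \<noteq> [] \<and> P = u # q @ [v]"
    and "\<And>P Q. P \<in> Ps \<Longrightarrow> Q \<in> Ps \<Longrightarrow> P \<noteq> Q \<Longrightarrow> inner_vertices P \<inter> inner_vertices Q = {}"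
proof -
  obtain Ps where Ps: "finite Ps" "card Ps = k"
    "\<forall>P\<in>Ps. is_path E P \<and> hd P = u \<and> last P = v \<and> monochromatic c P"
    "\<forall>P\<in>Ps. \<forall>Q\<in>Ps. P \<noteq> Q \<longrightarrow> inner_vertices P \<inter> inner_vertices Q = {}"
    using linked[of u v] assms unfolding k_mono_linked_def by blast
  have form: "\<exists>q. q \<noteq> [] \<and> P = u # q @ [v]" if "P \<in> Ps" for P
  proof -
    have P: "is_path E P" "hd P = u" "last P = v" using Ps that by auto
    then obtain P1 where P1: "P = u # P1" unfolding is_path_def by (cases P) auto
    then have "P1 \<noteq> []" using P \<open>u \<noteq> v\<close> by auto
    then have Pq: "P = u # butlast P1 @ [v]" using P1 P by auto
    have "butlast P1 \<noteq> []"
    proof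
      assume "butlast P1 = []"
      then have "{u, v} \<in> E" using P(1) Pq unfolding is_path_def by (simp add: path_edges_def)
      then show False using edge_at_B[of "{u, v}" u] u v \<open>u \<noteq> v\<close> disjoint
        by (auto simp: doubleton_eq_iff)
    qed
    with Pq show ?thesis by blast
  qed
  have colour: "\<exists>i\<in>big. is_path (cls i) P" if PPs: "P \<in> Ps" for P
  proof -
    have P: "is_path E P" "monochromatic c P" using Ps that by auto
    then obtain i where i: "path_edges P \<subseteq> cls i"
      unfolding monochromatic_def is_path_def cls_def by blast
    obtain q where "q \<noteq> []" "P = u # q @ [v]" using form[OF PPs] by blast
    then obtain a zs where a: "P = u # a # zs @ [v]" by (cases q) auto
    then obtain b ws where b: "P = u # a # b # ws" by (cases zs) auto
    have "{u, a} \<in> path_edges P" "{a, b} \<in> path_edges P"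
      unfolding b by (auto simp: path_edges_Cons_Cons)
    moreover have "{u, a} \<noteq> {a, b}" using P(1) unfolding b is_path_def by (auto simp: doubleton_eq_iff)
    ultimately have "card {{u, a}, {a, b}} = 2" "{{u, a}, {a, b}} \<subseteq> cls i" using i by auto
    then have "2 \<le> card (cls i)" "{u, a} \<in> cls i" using card_mono[OF finite_cls] by (metis, auto)
    then have "i \<in> big" unfolding big_def cls_def by auto
    then show ?thesis using i P(1) unfolding is_path_def by auto
  qed
  show thesis by (rule that[OF Ps(1,2) colour form]) (use Ps(4) in auto)
qed

text \<open>Inner vertices are disjoint, so paths of one colour leave \<open>u\<close> through
  different edges and enter \<open>v\<close> through different edges. Each path has an edge and
  hence only one colour, which makes the counts add up to \<open>k\<close>.\<close>

lemma linking_path_counts: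
  assumes "u \<in> B" "v \<in> B" "u \<noteq> v"
    and Ps: "finite Ps" "card Ps = k"
    and colour: "\<And>P. P \<in> Ps \<Longrightarrow> \<exists>i\<in>big. is_path (cls i) P"
    and form: "\<And>P. P \<in> Ps \<Longrightarrow> \<exists>q. q \<noteq> [] \<and> P = u # q @ [v]"
    and disj: "\<And>P Q. P \<in> Ps \<Longrightarrow> Q \<in> Ps \<Longrightarrow> P \<noteq> Q \<Longrightarrow> inner_vertices P \<inter> inner_vertices Q = {}"
  shows "card {P \<in> Ps. is_path (cls i) P} \<le> deg i u"
    and "card {P \<in> Ps. is_path (cls i) P} \<le> deg i v"
    and "(\<Sum>i\<in>big. card {P \<in> Ps. is_path (cls i) P}) = k"
proof -
  have fins: "finite {e \<in> cls i. w \<in> e}" for w using finite_cls by auto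
  have inner: "inner_vertices (u # q @ [v]) = set q" for q :: "'a list"
    unfolding inner_vertices_def by simp
  define first where "first P = {u, hd (tl P)}" for P :: "'a list"
  define final where "final P = {last (butlast P), v}" for P :: "'a list"
  have ends: "first P \<in> cls i \<and> final P \<in> cls i \<and> hd (tl P) \<in> inner_vertices P \<and> hd (tl P) \<noteq> u \<and>
      last (butlast P) \<in> inner_vertices P \<and> last (butlast P) \<noteq> v"
    if P: "P \<in> {P \<in> Ps. is_path (cls i) P}" for P
  proof -
    obtain q where q: "q \<noteq> []" "P = u # q @ [v]" using form P by blast
    have "successively (\<lambda>a b. {a, b} \<in> cls i) (u # q @ [v])" "distinct (u # q @ [v])"
      using P q unfolding is_path_def path_edges_subset_iff by auto
    then show ?thesis using q unfolding first_def final_def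
      by (auto simp: inner successively_append_iff successively_Cons butlast_append)
  qed
  have inj: "inj_on first {P \<in> Ps. is_path (cls i) P}" "inj_on final {P \<in> Ps. is_path (cls i) P}"
  proof -
    show "inj_on first {P \<in> Ps. is_path (cls i) P}"
    proof (rule inj_onI, rule ccontr)
      fix P Q assume PQ: "P \<in> {P \<in> Ps. is_path (cls i) P}" "Q \<in> {P \<in> Ps. is_path (cls i) P}"
        "first P = first Q" "P \<noteq> Q"
      then have "hd (tl P) = hd (tl Q)" using ends[OF PQ(1)] ends[OF PQ(2)]
        unfolding first_def by (auto simp: doubleton_eq_iff)
      then have "hd (tl P) \<in> inner_vertices P \<inter> inner_vertices Q"
        using ends[OF PQ(1)] ends[OF PQ(2)] by auto
      then show False using disj[of P Q] PQ by auto
    qed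
    show "inj_on final {P \<in> Ps. is_path (cls i) P}"
    proof (rule inj_onI, rule ccontr)
      fix P Q assume PQ: "P \<in> {P \<in> Ps. is_path (cls i) P}" "Q \<in> {P \<in> Ps. is_path (cls i) P}"
        "final P = final Q" "P \<noteq> Q"
      then have "last (butlast P) = last (butlast Q)" using ends[OF PQ(1)] ends[OF PQ(2)]
        unfolding final_def by (auto simp: doubleton_eq_iff)
      then have "last (butlast P) \<in> inner_vertices P \<inter> inner_vertices Q"
        using ends[OF PQ(1)] ends[OF PQ(2)] by auto
      then show False using disj[of P Q] PQ by auto
    qed
  qed
  show "card {P \<in> Ps. is_path (cls i) P} \<le> deg i u"
    unfolding deg_def by (rule card_inj_on_le[OF inj(1)]) (use ends fins in \<open>auto simp: first_def\<close>)
  show "card {P \<in> Ps. is_path (cls i) P} \<le> deg i v"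
    unfolding deg_def by (rule card_inj_on_le[OF inj(2)]) (use ends fins in \<open>auto simp: final_def\<close>)
  have "Ps = (\<Union>i\<in>big. {P \<in> Ps. is_path (cls i) P})" using colour by auto
  also have "card \<dots> = (\<Sum>i\<in>big. card {P \<in> Ps. is_path (cls i) P})"
  proof (rule card_UN_disjoint)
    show "\<forall>i\<in>big. \<forall>j\<in>big. i \<noteq> j \<longrightarrow> {P \<in> Ps. is_path (cls i) P} \<inter> {P \<in> Ps. is_path (cls j) P} = {}"
    proof (intro ballI impI equals0I)
      fix i j P assume "i \<noteq> j" and P: "P \<in> {P \<in> Ps. is_path (cls i) P} \<inter> {P \<in> Ps. is_path (cls j) P}"
      then obtain q where "q \<noteq> []" "P = u # q @ [v]" using form by blast
      then have "{u, hd q} \<in> path_edges P" by (cases q) (auto simp: path_edges_Cons_Cons)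
      then have "{u, hd q} \<in> cls i \<inter> cls j" using P unfolding is_path_def by auto
      then show False using \<open>i \<noteq> j\<close> unfolding cls_def by auto
    qed
  qed (use finite_big Ps in auto)
  finally show "(\<Sum>i\<in>big. card {P \<in> Ps. is_path (cls i) P}) = k" using Ps by simp
qed

lemma sum_min_deg:
  assumes "u \<in> B" "v \<in> B" "u \<noteq> v"
  shows "k \<le> (\<Sum>i\<in>big. min (deg i u) (deg i v))"
proof -
  obtain Ps where Ps: "finite Ps" "card Ps = k"
    "\<And>P. P \<in> Ps \<Longrightarrow> \<exists>i\<in>big. is_path (cls i) P"
    "\<And>P. P \<in> Ps \<Longrightarrow> \<exists>q. q \<noteq> [] \<and> P = u # q @ [v]"
    "\<And>P Q. P \<in> Ps \<Longrightarrow> Q \<in> Ps \<Longrightarrow> P \<noteq> Q \<Longrightarrow> inner_vertices P \<inter> inner_vertices Q = {}"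
    using linking_paths[OF assms] by metis
  note cnt = linking_path_counts[OF assms Ps]
  have "(\<Sum>i\<in>big. card {P \<in> Ps. is_path (cls i) P}) \<le> (\<Sum>i\<in>big. min (deg i u) (deg i v))"
    using cnt(1,2) by (intro sum_mono) auto
  then show ?thesis using cnt(3) by simp
qed

lemma sum_deg_ge:
  assumes "v \<in> B" "2 \<le> card B"
  shows "k \<le> (\<Sum>i\<in>big. deg i v)"
proof -
  have "card {v} < card B" using assms by simp
  then obtain u where u: "u \<in> B" "u \<noteq> v"
    using card_gt_imp_ex_not_in[of "{v}" B] by auto
  have "(\<Sum>i\<in>big. min (deg i u) (deg i v)) \<le> (\<Sum>i\<in>big. deg i v)" by (intro sum_mono) auto
  then show ?thesis using sum_min_deg[OF u(1) assms(1) u(2)] by simp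
qed

text \<open>The minima sum to at least \<open>k\<close>, which is already the sum of the degrees at
  \<open>v\<close>; so each minimum equals \<open>deg i v\<close>.\<close>

lemma deg_le_if_tight:
  assumes "u \<in> B" "v \<in> B" "u \<noteq> v" and tight: "(\<Sum>i\<in>big. deg i v) = k" and "i \<in> big"
  shows "deg i v \<le> deg i u"
proof -
  have "(\<Sum>i\<in>big. min (deg i u) (deg i v)) \<le> (\<Sum>i\<in>big. deg i v)" by (intro sum_mono) auto
  then have "(\<Sum>i\<in>big. min (deg i u) (deg i v)) = (\<Sum>i\<in>big. deg i v)"
    using sum_min_deg[OF assms(1-3)] tight by simp
  then have "min (deg i u) (deg i v) = deg i v"
    by (rule sum_mono_inv) (use assms finite_big in auto)
  then show ?thesis by linarith
qed

lemma sum_deg_all: "(\<Sum>v\<in>B. \<Sum>i\<in>big. deg i v) = (\<Sum>i\<in>big. card (cls i))"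
  by (subst sum.swap) (simp add: sum_deg)

text \<open>The edges at \<open>v\<close> have distinct other ends in \<open>A\<close>.\<close>

lemma sum_deg_le:
  assumes "v \<in> B"
  shows "(\<Sum>i\<in>big. deg i v) \<le> card A"
proof -
  have "(\<Sum>i\<in>big. deg i v) = card (\<Union>i\<in>big. {e \<in> cls i. v \<in> e})"
    unfolding deg_def
    by (rule card_UN_disjoint[symmetric]) (use finite_big finite_E in \<open>auto simp: cls_def\<close>)
  also have "\<dots> \<le> card ((\<lambda>a. {a, v}) ` A)"
    by (rule card_mono) (use finite_A edge_at_B assms in \<open>auto simp: cls_def\<close>)
  also have "\<dots> \<le> card A" using finite_A by (rule card_image_le)
  finally show ?thesis .
qed

section \<open>Spanning stars, spanning cycles and the upper bound for k \<le> 3\<close>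

lemma deg_eq_0_iff: "deg i v = 0 \<longleftrightarrow> (\<forall>e\<in>cls i. v \<notin> e)"
  unfolding deg_def using finite_cls[of i] by auto

text \<open>A connected colour with degree 1 on all of \<open>B\<close> is a star whose centre
  \<open>x\<close> lies in \<open>A\<close> and which uses every edge at \<open>x\<close>. Another
  vertex of \<open>A\<close> must share a colour with \<open>x\<close>, but the only colour at
  \<open>x\<close> misses it.\<close>

lemma no_spanning_star:
  assumes "i \<in> big" and one: "\<And>u. u \<in> B \<Longrightarrow> deg i u = 1" and "2 \<le> card A" "1 \<le> k"
  shows False
proof -
  obtain e0 where e0: "e0 \<in> cls i" using assms(1) unfolding big_def by fastforce
  then obtain x b0 where x: "x \<in> A" "b0 \<in> B" "e0 = {x, b0}" using edges unfolding cls_def by blast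
  define D where "D = {e \<in> cls i. x \<in> e}"
  \<comment> \<open>An edge of colour \<open>i\<close> that meets the star in some
    \<open>b \<in> B\<close> is the star edge at \<open>b\<close>, since
    \<open>deg i b = 1\<close>.\<close>
  have closed: "f \<in> D" if ef: "e \<in> D" "f \<in> cls i" "e \<inter> f \<noteq> {}" for e f
  proof -
    obtain w where w: "w \<in> e" "w \<in> f" using ef by auto
    obtain a b where ab: "a \<in> A" "b \<in> B" "e = {a, b}"
      using ef edges unfolding D_def cls_def by blast
    have "a = x" using ef x ab disjoint unfolding D_def by auto
    show "f \<in> D"
    proof (cases "w = x")
      case True
      then show ?thesis using ef w unfolding D_def by auto
    next
      case False
      then have "w = b" using w ab \<open>a = x\<close> by auto
      have "card {e \<in> cls i. b \<in> e} = 1" using one[OF ab(2)] unfolding deg_def .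
      then obtain g where g: "{e \<in> cls i. b \<in> e} = {g}" by (auto simp: card_1_singleton_iff)
      have "e \<in> {e \<in> cls i. b \<in> e}" "f \<in> {e \<in> cls i. b \<in> e}"
        using ef w \<open>w = b\<close> unfolding D_def by auto
      then have "e = f" unfolding g by auto
      then show ?thesis using ef by auto
    qed
  qed
  have "D \<subseteq> cls i" "D \<noteq> {}" using e0 x unfolding D_def by auto
  then have D: "D = cls i" using edge_connectedD[OF connected_cls] closed by blast
  have star: "{x, b} \<in> cls i" if "b \<in> B" for b
  proof -
    have "deg i b \<noteq> 0" using one[OF that] by simp
    then obtain e where e: "e \<in> cls i" "b \<in> e" unfolding deg_eq_0_iff by auto
    then have "x \<in> e" "e \<in> E" using D unfolding D_def cls_def by auto
    then have "e = {x, b}" using edge_at_B[of e b] e that x disjoint by auto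
    then show ?thesis using e by simp
  qed
  have "card {x} < card A" using assms by simp
  then obtain y where y: "y \<in> A" "y \<noteq> x" using card_gt_imp_ex_not_in[of "{x}" A] by auto
  have "1 \<le> (\<Sum>j\<in>big. min (deg j x) (deg j y))"
    using bipartite_mono_colouring.sum_min_deg[OF swap x(1) y(1)] y(2) assms(4) by auto
  then have "(\<Sum>j\<in>big. min (deg j x) (deg j y)) \<noteq> 0" by simp
  then obtain j where j: "j \<in> big" "min (deg j x) (deg j y) \<noteq> 0"
    by (rule sum.not_neutral_contains_not_neutral)
  then have "deg j x \<noteq> 0" "deg j y \<noteq> 0" by auto
  then obtain f g where f: "f \<in> cls j" "x \<in> f" and g: "g \<in> cls j" "y \<in> g"
    unfolding deg_eq_0_iff by blast
  then obtain b where "b \<in> B" "f = {x, b}"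
    using edges[of f] x disjoint unfolding cls_def by auto
  then have "j = i" using star[of b] f unfolding cls_def by auto
  then have "x \<in> g" using g D unfolding D_def by auto
  moreover have "g \<in> E" using g unfolding cls_def by auto
  ultimately show False using edges[of g] g x y disjoint by auto
qed

text \<open>The linking inequality is summed over all \<open>u \<noteq> v\<close>. A colour present
  at \<open>v\<close> contributes at most its size minus 1; a colour missing \<open>v\<close>
  contributes 0 although it has at least two edges, which yields the additional 1.\<close>

lemma card_big_bound:
  assumes "v \<in> B"
  shows "k * (card B - 1) + card big + card {i \<in> big. deg i v = 0} \<le> (\<Sum>i\<in>big. card (cls i))"
proof -
  have cB: "card (B - {v}) = card B - 1" using assms finite_B by simp
  have each: "(\<Sum>u\<in>B - {v}. min (deg i u) (deg i v)) + 1 + (if deg i v = 0 then 1 else 0) \<le> card (cls i)"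
    if "i \<in> big" for i
  proof (cases "deg i v = 0")
    case True
    then show ?thesis using that unfolding big_def by simp
  next
    case False
    have "(\<Sum>u\<in>B - {v}. min (deg i u) (deg i v)) \<le> (\<Sum>u\<in>B - {v}. deg i u)"
      by (intro sum_mono) auto
    moreover have "deg i v + (\<Sum>u\<in>B - {v}. deg i u) = card (cls i)"
      using sum.remove[OF finite_B assms, of "deg i"] sum_deg[of i] by simp
    ultimately show ?thesis using False by simp
  qed
  have "k * (card B - 1) = (\<Sum>u\<in>B - {v}. k)" using cB by simp
  also have "\<dots> \<le> (\<Sum>u\<in>B - {v}. \<Sum>i\<in>big. min (deg i u) (deg i v))"
    by (intro sum_mono sum_min_deg) (use assms in auto)
  also have "\<dots> = (\<Sum>i\<in>big. \<Sum>u\<in>B - {v}. min (deg i u) (deg i v))" by (rule sum.swap)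
  finally have "k * (card B - 1) + card big + card {i \<in> big. deg i v = 0}
      \<le> (\<Sum>i\<in>big. \<Sum>u\<in>B - {v}. min (deg i u) (deg i v)) + (\<Sum>i\<in>big. 1)
        + (\<Sum>i\<in>big. if deg i v = 0 then 1 else 0)"
    using finite_big by (simp add: sum.If_cases Int_def)
  also have "\<dots> = (\<Sum>i\<in>big. (\<Sum>u\<in>B - {v}. min (deg i u) (deg i v)) + 1 + (if deg i v = 0 then 1 else 0))"
    by (simp only: sum.distrib)
  also have "\<dots> \<le> (\<Sum>i\<in>big. card (cls i))" by (intro sum_mono each)
  finally show ?thesis .
qed

theorem waste_ge_if_k_le_3:
  assumes k: "2 \<le> k" "k \<le> 3" and s: "k \<le> card A" "card A \<le> card B"
  shows "k * card B + card big \<le> (\<Sum>i\<in>big. card (cls i)) + 1"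
proof (rule ccontr)
  define M where "M = (\<Sum>i\<in>big. card (cls i))"
  define t where "t = card B"
  assume "\<not> ?thesis"
  then have less: "M + 2 \<le> k * t + card big" unfolding M_def t_def by simp
  have t: "2 \<le> t" "B \<noteq> {}" using k s unfolding t_def by auto
  \<comment> \<open>Comparison with \<open>less\<close> leaves at most \<open>k - 2 \<le> 1\<close>
    colours that miss \<open>v\<close>; each of the others uses up one of the at most
    \<open>card A\<close> edges at \<open>v\<close>.\<close>
  have few: "card big \<le> card A + 1" if "v \<in> B" for v
  proof -
    have "k * (t - 1) + k = k * t" using t by (cases t) auto
    then have "card {i \<in> big. deg i v = 0} \<le> 1"
      using card_big_bound[OF that] less k unfolding M_def t_def by linarith
    moreover have "card big = card {i \<in> big. deg i v = 0} + card {i \<in> big. deg i v \<noteq> 0}"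
      using finite_big by (subst card_Un_disjoint[symmetric]) (auto intro: arg_cong[where f = card])
    moreover have "card {i \<in> big. deg i v \<noteq> 0} \<le> card A"
    proof -
      have "card {i \<in> big. deg i v \<noteq> 0} = (\<Sum>i\<in>{i \<in> big. deg i v \<noteq> 0}. 1)" by simp
      also have "\<dots> \<le> (\<Sum>i\<in>{i \<in> big. deg i v \<noteq> 0}. deg i v)" by (intro sum_mono) auto
      also have "\<dots> \<le> (\<Sum>i\<in>big. deg i v)" by (rule sum_mono2) (use finite_big in auto)
      also have "\<dots> \<le> card A" using sum_deg_le[OF that] .
      finally show ?thesis .
    qed
    ultimately show ?thesis by linarith
  qed
  \<comment> \<open>If every total degree were at least \<open>k + 1\<close>, then
    \<open>less\<close> would force \<open>t + 2\<close> big colours, more than the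
    \<open>card A + 1\<close> just allowed.\<close>
  have "\<exists>v\<in>B. (\<Sum>i\<in>big. deg i v) = k"
  proof (rule ccontr)
    assume no: "\<not> ?thesis"
    have "k + 1 \<le> (\<Sum>i\<in>big. deg i v)" if "v \<in> B" for v
      using sum_deg_ge[OF that] no that t unfolding t_def by fastforce
    then have "(\<Sum>v\<in>B. k + 1) \<le> (\<Sum>v\<in>B. \<Sum>i\<in>big. deg i v)" by (intro sum_mono)
    then have "(k + 1) * t \<le> M" unfolding sum_deg_all M_def t_def by (simp add: mult.commute)
    then have "t + 2 \<le> card big" using less by simp
    moreover obtain w where "w \<in> B" using t by auto
    ultimately show False using few[of w] s unfolding t_def by linarith
  qed
  then obtain v where v: "v \<in> B" "(\<Sum>i\<in>big. deg i v) = k" by blast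
  have ge: "deg i v \<le> deg i u" if "u \<in> B" "i \<in> big" for u i
    using deg_le_if_tight[OF that(1) v(1) _ v(2) that(2)] by (cases "u = v") auto
  have ge_cls: "t * deg i v \<le> card (cls i)" if "i \<in> big" for i
  proof -
    have "(\<Sum>u\<in>B. deg i v) \<le> (\<Sum>u\<in>B. deg i u)" using ge that by (intro sum_mono)
    then show ?thesis unfolding sum_deg t_def by simp
  qed
  \<comment> \<open>Otherwise every colour has at least \<open>t * deg i v + 1\<close> edges, except
    that one edge may be lacking if \<open>2 \<le> deg i v\<close>. For \<open>k \<le> 3\<close>
    there is at most one such colour, because the degrees at \<open>v\<close> add up to
    \<open>k\<close>.\<close>
  have "\<exists>i\<in>big. deg i v = 1 \<and> card (cls i) = t"
  proof (rule ccontr)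
    assume no: "\<not> ?thesis"
    have each: "t * deg i v + 1 \<le> card (cls i) + (if 2 \<le> deg i v then 1 else 0)" if "i \<in> big" for i
    proof -
      from that no have "\<not> (deg i v = 1 \<and> card (cls i) = t)" by blast
      then consider "deg i v = 0" | "deg i v = 1" "card (cls i) \<noteq> t" | "2 \<le> deg i v"
        by linarith
      then show ?thesis using ge_cls[OF that] that unfolding big_def by cases auto
    qed
    have "(\<Sum>i\<in>big. t * deg i v + 1) \<le> (\<Sum>i\<in>big. card (cls i) + (if 2 \<le> deg i v then 1 else 0))"
      by (intro sum_mono each)
    moreover have "(\<Sum>i\<in>big. t * deg i v + 1) = t * k + card big"
      unfolding sum.distrib v(2)[symmetric] sum_distrib_left by simp
    ultimately have "t * k + card big \<le> M + card {i \<in> big. 2 \<le> deg i v}"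
      using finite_big unfolding M_def by (simp add: sum.distrib sum.If_cases Int_def)
    moreover have "2 * card {i \<in> big. 2 \<le> deg i v} \<le> k"
    proof -
      have "2 * card {i \<in> big. 2 \<le> deg i v} = (\<Sum>i\<in>{i \<in> big. 2 \<le> deg i v}. 2)" by simp
      also have "\<dots> \<le> (\<Sum>i\<in>{i \<in> big. 2 \<le> deg i v}. deg i v)" by (intro sum_mono) auto
      also have "\<dots> \<le> (\<Sum>i\<in>big. deg i v)" by (rule sum_mono2) (use finite_big in auto)
      finally show ?thesis using v(2) by simp
    qed
    ultimately show False using less k by (simp add: mult.commute)
  qed
  then obtain i where i: "i \<in> big" "deg i v = 1" "card (cls i) = t" by blast
  have "deg i u = 1" if "u \<in> B" for u
  proof -
    have "(\<Sum>u\<in>B. 1) = (\<Sum>u\<in>B. deg i u)" using i(3) unfolding sum_deg t_def by simp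
    then show ?thesis
      by (rule sum_mono_inv[symmetric]) (use ge[OF _ i(1)] i(2) that finite_B in auto)
  qed
  then show False using no_spanning_star[OF i(1)] k s by auto
qed

text \<open>As \<open>v\<close> has total degree \<open>k\<close>, exactly \<open>deg l v\<close> of
  the linking paths have colour \<open>l\<close>. The two of colour \<open>i\<close> form a cycle
  that, by connectedness and 2-regularity, is the whole colour class and covers all vertices, so a
  path of colour \<open>j\<close> has no room for an inner vertex.\<close>

lemma no_spanning_cycle:
  assumes "i \<in> big" "j \<in> big" "i \<noteq> j" and two: "\<And>w. w \<in> A \<union> B \<Longrightarrow> deg i w = 2"
    and uv: "u \<in> B" "v \<in> B" "u \<noteq> v" and tight: "(\<Sum>i\<in>big. deg i v) = k" and "1 \<le> deg j v"
  shows False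
proof -
  obtain Ps where Ps: "finite Ps" "card Ps = k"
    "\<And>P. P \<in> Ps \<Longrightarrow> \<exists>i\<in>big. is_path (cls i) P"
    "\<And>P. P \<in> Ps \<Longrightarrow> \<exists>q. q \<noteq> [] \<and> P = u # q @ [v]"
    "\<And>P Q. P \<in> Ps \<Longrightarrow> Q \<in> Ps \<Longrightarrow> P \<noteq> Q \<Longrightarrow> inner_vertices P \<inter> inner_vertices Q = {}"
    using linking_paths[OF uv] by metis
  note cnt = linking_path_counts[OF uv Ps]
  have n: "card {P \<in> Ps. is_path (cls l) P} = deg l v" if "l \<in> big" for l
  proof -
    have "(\<Sum>i\<in>big. card {P \<in> Ps. is_path (cls i) P}) = (\<Sum>i\<in>big. deg i v)"
      using cnt(3) tight by simp
    then show ?thesis by (rule sum_mono_inv) (use cnt(2) that finite_big in auto)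
  qed
  have "card {P \<in> Ps. is_path (cls i) P} = 2" using n[OF assms(1)] two uv by simp
  then obtain P1 P2 where P12: "{P \<in> Ps. is_path (cls i) P} = {P1, P2}" "P1 \<noteq> P2"
    by (auto simp: card_2_iff)
  have "{P \<in> Ps. is_path (cls j) P} \<noteq> {}"
  proof
    assume "{P \<in> Ps. is_path (cls j) P} = {}"
    then have "card {P \<in> Ps. is_path (cls j) P} = 0" by (simp only: card.empty)
    then show False using n[OF assms(2)] \<open>1 \<le> deg j v\<close> by simp
  qed
  then obtain P3 where P3: "P3 \<in> Ps" "is_path (cls j) P3" by auto
  have P1: "P1 \<in> Ps" "is_path (cls i) P1" and P2: "P2 \<in> Ps" "is_path (cls i) P2"
    using P12 by auto
  obtain q1 where q1: "q1 \<noteq> []" "P1 = u # q1 @ [v]" using Ps(4)[OF P1(1)] by blast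
  obtain q2 where q2: "q2 \<noteq> []" "P2 = u # q2 @ [v]" using Ps(4)[OF P2(1)] by blast
  obtain q3 where q3: "q3 \<noteq> []" "P3 = u # q3 @ [v]" using Ps(4)[OF P3(1)] by blast
  have inner: "inner_vertices (u # q @ [v]) = set q" for q :: "'a list"
    unfolding inner_vertices_def by simp
  have d12: "set q1 \<inter> set q2 = {}" using Ps(5)[OF P1(1) P2(1) P12(2)] inner q1 q2 by simp
  have first: "{u, hd q} \<in> path_edges (u # q @ [v])" and final: "{last q, v} \<in> path_edges (u # q @ [v])"
    if "q \<noteq> []" for q
  proof -
    show "{u, hd q} \<in> path_edges (u # q @ [v])"
      using that by (cases q) (auto simp: path_edges_Cons_Cons)
    have "u # q @ [v] = (u # butlast q) @ last q # v # []" using that by simp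
    then show "{last q, v} \<in> path_edges (u # q @ [v])" unfolding in_path_edges_iff by blast
  qed
  have "P3 \<noteq> P1" "P3 \<noteq> P2"
  proof -
    have "{u, hd q3} \<in> cls j" using first[OF q3(1)] P3(2) q3(2) unfolding is_path_def by auto
    then have "\<not> is_path (cls i) P3"
      using first[OF q3(1)] q3(2) \<open>i \<noteq> j\<close> unfolding is_path_def cls_def by auto
    then show "P3 \<noteq> P1" "P3 \<noteq> P2" using P1 P2 by auto
  qed
  then have d3: "set q3 \<inter> (set q1 \<union> set q2) = {}"
    using Ps(5)[OF P3(1) P1(1)] Ps(5)[OF P3(1) P2(1)] inner q1 q2 q3 by auto
  define D where "D = path_edges P1 \<union> path_edges P2"
  have DC: "D \<subseteq> cls i" using P1 P2 unfolding D_def is_path_def by auto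
  have vertices: "w \<in> set P1 \<union> set P2" if "e \<in> D" "w \<in> e" for e w
    using that unfolding D_def in_path_edges_iff Un_iff by auto
  have "D \<noteq> {}" using first[OF q1(1)] q1(2) unfolding D_def by auto
  have inner_two: "\<exists>e1\<in>path_edges P. \<exists>e2\<in>path_edges P. w \<in> e1 \<and> w \<in> e2 \<and> e1 \<noteq> e2"
    if P: "is_path (cls i) P" "P = u # q @ [v]" and w: "w \<in> set q" for P q w
  proof -
    obtain xs ys where q: "q = xs @ w # ys" using split_list[OF w] by blast
    define a b where "a = last (u # xs)" and "b = hd (ys @ [v])"
    have "P = butlast (u # xs) @ a # w # (ys @ [v])" unfolding P(2) q a_def by simp
    then have 1: "{a, w} \<in> path_edges P" unfolding in_path_edges_iff by blast
    have "P = (u # xs) @ w # b # tl (ys @ [v])" unfolding P(2) q b_def by simp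
    then have 2: "{w, b} \<in> path_edges P" unfolding in_path_edges_iff by blast
    have "distinct ((u # xs) @ w # (ys @ [v]))" using P unfolding is_path_def q by simp
    moreover have "a \<in> set (u # xs)" "b \<in> set (ys @ [v])"
      unfolding a_def b_def by (auto simp: hd_append)
    ultimately have "a \<noteq> b" "a \<noteq> w" by auto
    then have "{a, w} \<noteq> {w, b}" by (auto simp: doubleton_eq_iff)
    then show ?thesis by (intro bexI[OF _ 1] bexI[OF _ 2]) simp
  qed
  \<comment> \<open>An inner vertex has the edges to its two neighbours on its path;
    \<open>u\<close> and \<open>v\<close> get one edge from each of the two paths.\<close>
  have two_edges: "\<exists>e1\<in>D. \<exists>e2\<in>D. w \<in> e1 \<and> w \<in> e2 \<and> e1 \<noteq> e2" if w: "w \<in> set P1 \<union> set P2" for w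
  proof -
    have hds: "hd q1 \<noteq> hd q2"
      using d12 hd_in_set[OF q1(1)] hd_in_set[OF q2(1)] by (metis disjoint_iff)
    have lasts: "last q1 \<noteq> last q2"
      using d12 last_in_set[OF q1(1)] last_in_set[OF q2(1)] by (metis disjoint_iff)
    consider "w \<in> set q1" | "w \<in> set q2" | "w = u" | "w = v" using w q1 q2 by auto
    then show ?thesis
    proof cases
      case 1
      from inner_two[OF P1(2) q1(2) this] show ?thesis unfolding D_def by (meson UnI1)
    next
      case 2
      from inner_two[OF P2(2) q2(2) this] show ?thesis unfolding D_def by (meson UnI2)
    next
      case 3
      have "{u, hd q1} \<noteq> {u, hd q2}" using hds by (auto simp: doubleton_eq_iff)
      moreover have D: "{u, hd q1} \<in> D" "{u, hd q2} \<in> D"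
        using first[OF q1(1)] first[OF q2(1)] q1(2) q2(2) unfolding D_def by auto
      ultimately show ?thesis using 3 by (intro bexI[OF _ D(1)] bexI[OF _ D(2)]) simp
    next
      case 4
      have "{last q1, v} \<noteq> {last q2, v}" using lasts by (auto simp: doubleton_eq_iff)
      moreover have D: "{last q1, v} \<in> D" "{last q2, v} \<in> D"
        using final[OF q1(1)] final[OF q2(1)] q1(2) q2(2) unfolding D_def by auto
      ultimately show ?thesis using 4 by (intro bexI[OF _ D(1)] bexI[OF _ D(2)]) simp
    qed
  qed
  have inAB: "w \<in> A \<union> B" if "e \<in> E" "w \<in> e" for e w using edges[OF that(1)] that(2) by auto
  \<comment> \<open>\<open>D\<close> already contains two edges at each of its vertices, and degree
    2 leaves no third edge of colour \<open>i\<close>.\<close>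
  have closed: "f \<in> D" if ef: "e \<in> D" "f \<in> cls i" "e \<inter> f \<noteq> {}" for e f
  proof -
    obtain w where w: "w \<in> e" "w \<in> f" using ef by auto
    from two_edges[OF vertices[OF ef(1) w(1)]]
    obtain e1 e2 where e12: "e1 \<in> D" "e2 \<in> D" "w \<in> e1" "w \<in> e2" "e1 \<noteq> e2"
      by (elim bexE conjE) (rule that)
    have "card {e1, e2} = card {e \<in> cls i. w \<in> e}"
      using two[of w] inAB[of f w] w ef e12 unfolding deg_def cls_def by auto
    moreover have "{e1, e2} \<subseteq> {e \<in> cls i. w \<in> e}" using e12 DC by auto
    ultimately have eq: "{e1, e2} = {e \<in> cls i. w \<in> e}"
      using finite_cls[of i] by (intro card_subset_eq) auto
    have "f \<in> {e \<in> cls i. w \<in> e}" using ef(2) w(2) by simp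
    then have "f = e1 \<or> f = e2" unfolding eq[symmetric] by simp
    then show ?thesis using e12(1,2) by metis
  qed
  have D: "D = cls i" by (rule edge_connectedD[OF connected_cls DC \<open>D \<noteq> {}\<close> closed])
  \<comment> \<open>Some inner vertex of the third path; it has edges of colour \<open>i\<close> and
    therefore lies on the cycle.\<close>
  define w where "w = hd q3"
  have w: "w \<in> set q3" unfolding w_def using q3 by auto
  have "{u, w} \<in> E" using first[OF q3(1)] q3(2) P3(2) unfolding w_def is_path_def cls_def by auto
  then have "deg i w \<noteq> 0" using two[of w] inAB[of "{u, w}" w] by auto
  then obtain e where "e \<in> cls i" "w \<in> e" unfolding deg_eq_0_iff by auto
  then have "w \<in> set P1 \<union> set P2" using vertices D by auto
  moreover have "w \<noteq> u" "w \<noteq> v" using w P3(2) unfolding q3(2) is_path_def by auto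
  ultimately show False using d3 w q1 q2 by auto
qed

end

section \<open>Balanced bipartite graphs\<close>

text \<open>In a balanced graph with classes of size \<open>t\<close>, \<open>e\<close> is the number of edges of a colour and
  \<open>q\<close> bounds the number of its paths over all ordered pairs in a common class. A \<open>k\<close>-regular
  spanning colour has \<open>q = 2 k t (t - 1)\<close>; the weights are chosen so that the deficit vanishes
  for a Hamilton cycle, the colour with the best ratio of \<open>q\<close> to \<open>e - 1\<close>.\<close>
lemma deficit_nonneg:
  fixes t e q :: int
  assumes "1 \<le> t" "2 * t \<le> e" "q \<le> (2 * t - 2) * e"
  shows "0 \<le> 4 * t * (t - 1) * (e - 1) - (2 * t - 1) * q"
proof -
  have "(2 * t - 1) * q \<le> (2 * t - 1) * ((2 * t - 2) * e)"
    using assms by (intro mult_left_mono) auto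
  moreover have "0 \<le> (t - 1) * (2 * e - 4 * t)" using assms by (intro mult_nonneg_nonneg) auto
  moreover have "4 * t * (t - 1) * (e - 1) - (2 * t - 1) * ((2 * t - 2) * e) = (t - 1) * (2 * e - 4 * t)"
    by (simp add: algebra_simps)
  ultimately show ?thesis by linarith
qed

text \<open>The bound \<open>2 * t * (t - 1)\<close> is the total deficit that small waste still
  permits for \<open>k = 5\<close>; a single colour with fewer than \<open>2 * t\<close> edges
  exceeds it.\<close>

lemma deficit_large:
  fixes t e q :: int
  assumes t: "4 \<le> t" and e: "2 \<le> e" "e < 2 * t" and q: "q \<le> (e - 1) * e"
    and q': "e = 2 * t - 1 \<Longrightarrow> q \<le> 2 * ((t - 2) * e + t)"
  shows "2 * t * (t - 1) < 4 * t * (t - 1) * (e - 1) - (2 * t - 1) * q"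
proof (cases "e = 2 * t - 1")
  \<comment> \<open>Here \<open>(e - 1) * e\<close> would only give the negative deficit
    \<open>- (2 * t - 2)\<close>, so the bound from a vertex of degree at most 1 replaces
    it.\<close>
  case True
  have "2 * ((t - 2) * e + t) = 4 * (t - 1) * (t - 1)" unfolding True by (simp add: algebra_simps)
  then have "(2 * t - 1) * q \<le> (2 * t - 1) * (4 * (t - 1) * (t - 1))"
    using q'[OF True] t by (intro mult_left_mono) auto
  moreover have "4 * t * (t - 1) * (e - 1) - (2 * t - 1) * (4 * (t - 1) * (t - 1)) = 4 * (t - 1) * (t - 1)"
    unfolding True by (simp add: algebra_simps)
  moreover have "2 * t * (t - 1) < 4 * (t - 1) * (t - 1)"
    using t by (intro mult_strict_right_mono) auto
  ultimately show ?thesis by linarith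
next
  case False
  \<comment> \<open>The sum \<open>x + y\<close> is fixed, so \<open>(1 + x) * (1 + y)\<close> is at
    least \<open>1 + x + y = 2 * t - 3\<close>, attained at the ends of the range of
    \<open>e\<close>.\<close>
  define x y where "x = e - 2" and "y = 2 * t - 2 - e"
  have xy: "0 \<le> x" "0 \<le> y" "x + y = 2 * t - 4" using False e unfolding x_def y_def by auto
  have "(2 * t - 1) * q \<le> (2 * t - 1) * ((e - 1) * e)"
    using q t by (intro mult_left_mono) auto
  moreover have "4 * t * (t - 1) * (e - 1) - (2 * t - 1) * ((e - 1) * e)
      = (1 + x) * ((2 * t - 2) + (2 * t - 1) * y)"
    unfolding x_def y_def by (simp add: algebra_simps)
  moreover have "(1 + x) * ((2 * t - 2) * (1 + y)) \<le> (1 + x) * ((2 * t - 2) + (2 * t - 1) * y)"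
    using xy by (intro mult_left_mono) (auto simp: algebra_simps)
  moreover have "(2 * t - 2) * (2 * t - 3) \<le> (2 * t - 2) * ((1 + x) * (1 + y))"
  proof (rule mult_left_mono)
    have "0 \<le> x * y" using xy by simp
    then show "2 * t - 3 \<le> (1 + x) * (1 + y)" using xy(3) by (simp add: algebra_simps)
  qed (use t in auto)
  \<comment> \<open>The condition \<open>t < 2 * t - 3\<close> is exactly
    \<open>4 \<le> t\<close>.\<close>
  moreover have "(2 * t - 2) * t < (2 * t - 2) * (2 * t - 3)"
    using t by (intro mult_strict_left_mono) auto
  moreover have "(2 * t - 2) * t = 2 * t * (t - 1)" by (simp add: algebra_simps)
  moreover have "(2 * t - 2) * ((1 + x) * (1 + y)) = (1 + x) * ((2 * t - 2) * (1 + y))"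
    by (simp add: algebra_simps)
  ultimately show ?thesis by linarith
qed

section \<open>Counting linking paths over both classes\<close>

context bipartite_mono_colouring
begin

text \<open>For a class \<open>S\<close>, an upper bound on the number of linking paths of colour
  \<open>i\<close> over all ordered pairs of distinct vertices of \<open>S\<close>.\<close>

definition link_bound :: "'a set \<Rightarrow> 'c \<Rightarrow> nat" where
  "link_bound S i = (\<Sum>u\<in>S. \<Sum>v\<in>S - {u}. min (deg i u) (deg i v))"

lemma sum_link_bound_ge: "k * (card B * (card B - 1)) \<le> (\<Sum>i\<in>big. link_bound B i)"
proof -
  have "k * (card B * (card B - 1)) = (\<Sum>u\<in>B. \<Sum>v\<in>B - {u}. k)" using finite_B by simp
  also have "\<dots> \<le> (\<Sum>u\<in>B. \<Sum>v\<in>B - {u}. \<Sum>i\<in>big. min (deg i u) (deg i v))"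
    by (intro sum_mono sum_min_deg) auto
  also have "\<dots> = (\<Sum>u\<in>B. \<Sum>i\<in>big. \<Sum>v\<in>B - {u}. min (deg i u) (deg i v))"
    by (intro sum.cong refl sum.swap)
  also have "\<dots> = (\<Sum>i\<in>big. link_bound B i)" unfolding link_bound_def by (rule sum.swap)
  finally show ?thesis .
qed

lemma link_bound_le_card: "link_bound B i \<le> (card B - 1) * card (cls i)"
  using sum_min_offdiag_le[OF finite_B, of "deg i"] unfolding link_bound_def sum_deg .

lemma link_bound_le_support:
  "link_bound B i \<le> (card {u \<in> B. 0 < deg i u} - 1) * card (cls i)"
proof -
  have "sum (deg i) {u \<in> B. 0 < deg i u} = sum (deg i) B"
    by (rule sum.mono_neutral_left) (use finite_B in auto)
  then show ?thesis
    using sum_min_offdiag_le[of "{u \<in> B. 0 < deg i u}" "deg i"] finite_B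
    unfolding link_bound_def sum_offdiag_support[OF finite_B refl] sum_deg by simp
qed

text \<open>Fewer than \<open>2 * card B\<close> edges force a vertex of degree at most 1, whose row
  in the sum is small.\<close>

lemma link_bound_le_sparse:
  assumes "2 \<le> card B" "card (cls i) < 2 * card B"
  shows "link_bound B i \<le> (card B - 2) * card (cls i) + card B"
proof -
  have "\<exists>w\<in>B. deg i w \<le> 1"
  proof (rule ccontr)
    assume "\<not> ?thesis"
    then have "(\<Sum>w\<in>B. 2) \<le> (\<Sum>w\<in>B. deg i w)" by (intro sum_mono) auto
    then show False using assms(2) unfolding sum_deg by simp
  qed
  then obtain w where "w \<in> B" "deg i w \<le> 1" by blast
  then show ?thesis
    using sum_min_offdiag_le_if_small_weight[OF finite_B assms(1)] unfolding link_bound_def sum_deg[symmetric] by blast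
qed

text \<open>The two supports together form the vertex set of a connected graph, which has at most
  one vertex more than edges.\<close>

lemma card_supports:
  assumes "i \<in> big"
  shows "card {u \<in> A. 0 < deg i u} + card {u \<in> B. 0 < deg i u} \<le> card (cls i) + 1"
    and "0 < card {u \<in> B. 0 < deg i u}"
proof -
  have E: "e \<in> E" if "e \<in> cls i" for e using that unfolding cls_def by simp
  have "cls i \<noteq> {}" using assms unfolding big_def by auto
  have supp: "{u \<in> S. 0 < deg i u} = {u \<in> S. \<exists>e\<in>cls i. u \<in> e}" for S
    unfolding neq0_conv[symmetric] deg_eq_0_iff by simp
  have "card {u \<in> A. 0 < deg i u} + card {u \<in> B. 0 < deg i u}
      = card ({u \<in> A. 0 < deg i u} \<union> {u \<in> B. 0 < deg i u})"
    by (rule card_Un_disjoint[symmetric]) (use finite_A finite_B disjoint in auto)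
  also have "{u \<in> A. 0 < deg i u} \<union> {u \<in> B. 0 < deg i u} = \<Union>(cls i)"
    unfolding supp using edges[OF E] by blast
  also have "card \<dots> \<le> card (cls i) + 1"
  proof (rule card_Union_edge_connected[OF connected_cls finite_cls \<open>cls i \<noteq> {}\<close>])
    fix e assume "e \<in> cls i"
    then obtain a b where "a \<in> A" "b \<in> B" "e = {a, b}" using edges E by blast
    moreover from this have "a \<noteq> b" using disjoint by auto
    ultimately show "finite e \<and> card e = 2" by simp
  qed
  finally show "card {u \<in> A. 0 < deg i u} + card {u \<in> B. 0 < deg i u} \<le> card (cls i) + 1" .
  obtain e where "e \<in> cls i" using \<open>cls i \<noteq> {}\<close> by auto
  then obtain b where "b \<in> B" "b \<in> e" using edges E by blast
  then have "{u \<in> B. 0 < deg i u} \<noteq> {}" unfolding supp using \<open>e \<in> cls i\<close> by blast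
  then show "0 < card {u \<in> B. 0 < deg i u}" using finite_B by (simp add: card_gt_0_iff)
qed

text \<open>All deficits are nonnegative, and small waste bounds their sum by
  \<open>2 * T * (T - 1) * (k - 4)\<close>. For \<open>k \<le> 5\<close> this is less than the
  deficit of a single colour with fewer than \<open>2 * t\<close> edges.\<close>

lemma card_cls_ge:
  assumes t: "card A = t" "card B = t" and k: "k \<le> 5" "4 \<le> t"
    and less: "(\<Sum>i\<in>big. card (cls i)) + 2 \<le> k * t + card big" and "i \<in> big"
  shows "2 * t \<le> card (cls i)"
proof (rule ccontr)
  assume small: "\<not> ?thesis"
  note A = bipartite_mono_colouring.link_bound_le_card[OF swap]
    bipartite_mono_colouring.link_bound_le_support[OF swap]
    bipartite_mono_colouring.link_bound_le_sparse[OF swap]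
    bipartite_mono_colouring.sum_link_bound_ge[OF swap]
    bipartite_mono_colouring.card_supports(2)[OF swap]
  define q where "q j = int (link_bound A j + link_bound B j)" for j
  define e where "e j = int (card (cls j))" for j
  define T where "T = int t"
  define D where "D j = 4 * T * (T - 1) * (e j - 1) - (2 * T - 1) * q j" for j
  have e2: "2 \<le> e j" if "j \<in> big" for j using that unfolding big_def e_def by auto
  have T: "4 \<le> T" using k unfolding T_def by simp
  have q1: "q j \<le> (2 * T - 2) * e j" if "j \<in> big" for j
  proof -
    have "link_bound A j + link_bound B j \<le> 2 * ((t - 1) * card (cls j))"
      using A(1)[of j] link_bound_le_card[of j] t by simp
    then have "q j \<le> int (2 * ((t - 1) * card (cls j)))" unfolding q_def by (simp only: of_nat_le_iff)
    also have "\<dots> = (2 * T - 2) * e j" using T unfolding T_def e_def by (simp add: of_nat_diff algebra_simps)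
    finally show ?thesis .
  qed
  \<comment> \<open>Supports of sizes \<open>a\<close> and \<open>b\<close> give the factor
    \<open>(a - 1) + (b - 1)\<close>, at most \<open>card (cls j) - 1\<close> since the colour is
    connected. Positivity of \<open>a\<close> and \<open>b\<close> keeps the subtraction
    exact.\<close>
  have q2: "q j \<le> (e j - 1) * e j" if "j \<in> big" for j
  proof -
    define a b where "a = card {u \<in> A. 0 < deg j u}" and "b = card {u \<in> B. 0 < deg j u}"
    have ab: "a + b \<le> card (cls j) + 1" "0 < a" "0 < b"
      using card_supports[OF that] A(5)[OF that] unfolding a_def b_def by auto
    have "link_bound A j + link_bound B j \<le> (a - 1) * card (cls j) + (b - 1) * card (cls j)"
      using A(2)[of j] link_bound_le_support[of j] unfolding a_def b_def by (rule add_mono)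
    also have "\<dots> = ((a - 1) + (b - 1)) * card (cls j)" by (simp add: algebra_simps)
    also have "\<dots> \<le> (card (cls j) - 1) * card (cls j)" using ab by (intro mult_right_mono) auto
    finally have "q j \<le> int ((card (cls j) - 1) * card (cls j))" unfolding q_def by (simp only: of_nat_le_iff)
    then show ?thesis using e2[OF that] unfolding e_def by (simp add: of_nat_diff)
  qed
  have q3: "q j \<le> 2 * ((T - 2) * e j + T)" if "e j = 2 * T - 1" for j
  proof -
    have "card (cls j) < 2 * t" using that unfolding e_def T_def by linarith
    then have "link_bound A j + link_bound B j \<le> 2 * ((t - 2) * card (cls j) + t)"
      using A(3)[of j] link_bound_le_sparse[of j] t k by simp
    then have "q j \<le> int (2 * ((t - 2) * card (cls j) + t))" unfolding q_def by (simp only: of_nat_le_iff)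
    also have "\<dots> = 2 * ((T - 2) * e j + T)"
      using T unfolding T_def e_def by (simp add: of_nat_diff)
    finally show ?thesis .
  qed
  have big_D: "2 * T * (T - 1) < D j" if "j \<in> big" "e j < 2 * T" for j
    unfolding D_def using deficit_large[OF T e2[OF that(1)] that(2) q2[OF that(1)] q3] .
  have TT: "0 \<le> 2 * T * (T - 1)" using T by simp
  have D_nonneg: "0 \<le> D j" if "j \<in> big" for j
  proof (cases "e j < 2 * T")
    case True
    then show ?thesis using big_D[OF that True] TT by linarith
  next
    case False
    then show ?thesis unfolding D_def using deficit_nonneg[OF _ _ q1[OF that]] T by simp
  qed
  have "e i < 2 * T" using small unfolding e_def T_def by simp
  then have "2 * T * (T - 1) < D i" using big_D assms(6) by blast
  also have "\<dots> \<le> (\<Sum>j\<in>big. D j)"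
    by (rule member_le_sum) (use assms(6) D_nonneg finite_big in auto)
  also have "\<dots> = 4 * T * (T - 1) * (\<Sum>j\<in>big. e j - 1) - (2 * T - 1) * (\<Sum>j\<in>big. q j)"
    unfolding D_def by (subst sum_subtractf) (simp only: sum_distrib_left)
  also have "\<dots> \<le> 4 * T * (T - 1) * (int k * T - 2) - (2 * T - 1) * (2 * int k * (T * (T - 1)))"
  proof (rule diff_mono)
    have "(\<Sum>j\<in>big. e j - 1) = int (\<Sum>j\<in>big. card (cls j)) - int (card big)"
      unfolding e_def by (simp add: sum_subtractf)
    also have "\<dots> \<le> int k * T - 2"
    proof -
      have "int ((\<Sum>j\<in>big. card (cls j)) + 2) \<le> int (k * t + card big)"
        using less by (simp only: of_nat_le_iff)
      then show ?thesis unfolding T_def by simp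
    qed
    finally show "4 * T * (T - 1) * (\<Sum>j\<in>big. e j - 1) \<le> 4 * T * (T - 1) * (int k * T - 2)"
      using T by (intro mult_left_mono) auto
    have "k * (t * (t - 1)) + k * (t * (t - 1)) \<le> (\<Sum>j\<in>big. link_bound A j + link_bound B j)"
      unfolding sum.distrib using A(4) sum_link_bound_ge t by (intro add_mono) auto
    then have "int (k * (t * (t - 1)) + k * (t * (t - 1))) \<le> (\<Sum>j\<in>big. q j)"
      unfolding q_def of_nat_sum[symmetric] by (simp only: of_nat_le_iff)
    then have "2 * int k * (T * (T - 1)) \<le> (\<Sum>j\<in>big. q j)"
      using T unfolding T_def by (simp add: of_nat_diff)
    then show "(2 * T - 1) * (2 * int k * (T * (T - 1))) \<le> (2 * T - 1) * (\<Sum>j\<in>big. q j)"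
      using T by (intro mult_left_mono) auto
  qed
  also have "\<dots> = 2 * T * (T - 1) * (int k - 4)" by (simp add: algebra_simps)
  also have "\<dots> \<le> 2 * T * (T - 1) * 1" using k TT by (intro mult_left_mono) auto
  finally show False by simp
qed

text \<open>All total degrees are at least \<open>k\<close> and their average is
  \<open>k\<close>.\<close>

lemma tight_if_sum_eq:
  assumes "(\<Sum>i\<in>big. card (cls i)) = k * card B" "2 \<le> card B" "v \<in> B"
  shows "(\<Sum>i\<in>big. deg i v) = k"
proof -
  have "(\<Sum>v\<in>B. k) = (\<Sum>v\<in>B. \<Sum>i\<in>big. deg i v)" unfolding sum_deg_all using assms(1) by simp
  then show ?thesis
    by (rule sum_mono_inv[symmetric]) (use sum_deg_ge assms finite_B in auto)
qed

text \<open>When all vertices of \<open>B\<close> are tight, their degrees in a colour bound each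
  other in both directions and so are constant on \<open>B\<close>.\<close>

lemma card_cls_eq_if_tight:
  assumes "(\<Sum>i\<in>big. card (cls i)) = k * card B" "2 \<le> card B" "v \<in> B" "i \<in> big"
  shows "card (cls i) = card B * deg i v"
proof -
  have "deg i u = deg i v" if "u \<in> B" for u
    using deg_le_if_tight[OF that assms(3) _ tight_if_sum_eq[OF assms(1-3)] assms(4)]
      deg_le_if_tight[OF assms(3) that _ tight_if_sum_eq[OF assms(1,2) that] assms(4)]
    by (cases "u = v") auto
  then have "(\<Sum>u\<in>B. deg i u) = (\<Sum>u\<in>B. deg i v)" by (intro sum.cong) auto
  then show ?thesis unfolding sum_deg by simp
qed

theorem waste_ge_if_balanced:
  assumes t: "card A = t" "card B = t" and k: "4 \<le> k" "k \<le> 5" "k \<le> t"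
  shows "k * t + card big \<le> (\<Sum>i\<in>big. card (cls i)) + 1"
proof (rule ccontr)
  define M where "M = (\<Sum>i\<in>big. card (cls i))"
  assume "\<not> ?thesis"
  then have less: "M + 2 \<le> k * t + card big" unfolding M_def by simp
  have ge: "2 * t \<le> card (cls i)" if "i \<in> big" for i
    using card_cls_ge[OF t _ _ _ that] k less unfolding M_def by auto
  have "card big * (2 * t) \<le> M"
    using sum_mono[of big "\<lambda>_. 2 * t", OF ge] unfolding M_def by simp
  then have bound: "card big * (2 * t) + 2 \<le> k * t + card big" using less by linarith
  have kt: "k * t \<le> 5 * t" using k by (intro mult_right_mono) auto
  \<comment> \<open>Three colours with at least \<open>2 * t\<close> edges would waste at least
    \<open>3 * (2 * t - 1)\<close>, more than the permitted
    \<open>k * t - 2 \<le> 5 * t - 2\<close>.\<close>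
  have le2: "card big \<le> 2"
  proof (rule ccontr)
    assume "\<not> ?thesis"
    then obtain n where n: "card big = n + 3" using le_Suc_ex[of 3 "card big"] by auto
    have "n \<le> n * (2 * t)" using k by (cases t) auto
    moreover have "(n + 3) * (2 * t) = n * (2 * t) + 6 * t" by (simp add: algebra_simps)
    ultimately show False using bound kt k unfolding n by linarith
  qed
  have M_ge: "k * t \<le> M"
  proof -
    have "(\<Sum>v\<in>B. k) \<le> (\<Sum>v\<in>B. \<Sum>i\<in>big. deg i v)"
      by (intro sum_mono sum_deg_ge) (use t k in auto)
    then show ?thesis unfolding sum_deg_all M_def t by (simp add: t mult.commute)
  qed
  \<comment> \<open>\<open>k * t \<le> M\<close> and \<open>M + 2 \<le> k * t + card big\<close>
    force two colours; with exactly two, both inequalities are equalities.\<close>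
  have "card big = 2" using M_ge less le2 by linarith
  then have M: "M = k * t" using M_ge less by linarith
  obtain i j where ij: "big = {i, j}" "i \<noteq> j" using \<open>card big = 2\<close> by (auto simp: card_2_iff)
  have "card {} < card B" using t k by simp
  then obtain v where v: "v \<in> B" using card_gt_imp_ex_not_in[of "{}" B] by auto
  have "card {v} < card B" using t k by simp
  then obtain u where u: "u \<in> B" "u \<noteq> v" using card_gt_imp_ex_not_in[of "{v}" B] by auto
  have MB: "(\<Sum>i\<in>big. card (cls i)) = k * card B" and MA: "(\<Sum>i\<in>big. card (cls i)) = k * card A"
    using M t unfolding M_def by auto
  have two: "2 \<le> card B" "2 \<le> card A" using t k by auto
  have tight: "(\<Sum>i\<in>big. deg i v) = k" by (rule tight_if_sum_eq[OF MB two(1) v])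
  have clsB: "card (cls l) = t * deg l w" if "w \<in> B" "l \<in> big" for l w
    using card_cls_eq_if_tight[OF MB two(1) that] t by simp
  have clsA: "card (cls l) = t * deg l w" if "w \<in> A" "l \<in> big" for l w
    using bipartite_mono_colouring.card_cls_eq_if_tight[OF swap MA two(2) that] t by simp
  have deg2: "2 \<le> deg l v" if "l \<in> big" for l
    using ge[OF that] clsB[OF v that] k by (simp add: mult.commute)
  have absurd: False if "l \<in> big" "l' \<in> big" "l \<noteq> l'" "deg l v = 2" for l l'
  proof (rule no_spanning_cycle[OF that(1-3) _ u(1) v u(2) tight])
    fix w assume "w \<in> A \<union> B"
    then have "card (cls l) = t * deg l w" using clsA clsB that(1) by blast
    then show "deg l w = 2" using clsB[OF v that(1)] that(4) k by simp
  qed (use deg2[OF that(2)] in auto)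
  \<comment> \<open>Two degrees of at least 2 with sum at most 5: one of the colours is
    2-regular.\<close>
  have "deg i v + deg j v = k" using tight ij by simp
  then have "deg i v = 2 \<or> deg j v = 2" using deg2[of i] deg2[of j] ij k by auto
  then show False using absurd[of i j] absurd[of j i] ij by auto
qed

end

section \<open>The upper bound for arbitrary colourings and the value of mc\<close>

lemma card_colours_le:
  fixes c :: "'a set \<Rightarrow> nat"
  assumes k: "k \<in> {2, 3} \<or> (s = t \<and> k \<in> {2, 3, 4, 5})" "k \<le> s" "s \<le> t"
    and bip: "bipartite_parts V E s t" and fin: "finite V"
    and mono: "mono_k_connected_colouring k V E c"
  shows "card (c ` E) + k * t \<le> card E + 1"
proof -
  obtain A B where AB: "A \<inter> B = {}" "A \<union> B = V" "card A = s" "card B = t"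
    "\<forall>e\<in>E. \<exists>a\<in>A. \<exists>b\<in>B. e = {a, b}"
    using bip unfolding bipartite_parts_def by blast
  have "finite E"
  proof (rule finite_subset)
    show "E \<subseteq> Pow V" using AB by fastforce
  qed (use fin in simp)
  \<comment> \<open>The colouring is refined to connected colour classes, which the locale assumes;
    this loses no colours.\<close>
  obtain c' :: "'a set \<Rightarrow> 'a set set" where c': "mono_k_connected_colouring k V E c'"
    "\<And>i. edge_connected {e \<in> E. c' e = i}" "card (c ` E) \<le> card (c' ` E)"
    using ex_edge_connected_colouring[OF \<open>finite E\<close> mono] by blast
  interpret bipartite_mono_colouring A B E c' k
    by unfold_locales
      (use AB c' fin in \<open>auto simp: mono_k_connected_colouring_def\<close>)
  have "k * t + card big \<le> (\<Sum>i\<in>big. card (cls i)) + 1"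
  proof (cases "k \<le> 3")
    case True
    then show ?thesis using waste_ge_if_k_le_3 k AB by auto
  next
    case False
    then show ?thesis using waste_ge_if_balanced[of t] k AB by auto
  qed
  then show ?thesis using card_colours c'(3) by linarith
qed

theorem theorem3p4:
  fixes V :: "'a set" and E F :: "'a set set" and k s t :: nat
  assumes "k \<in> {2, 3} \<or> (s = t \<and> k \<in> {2, 3, 4, 5})"
    and "k \<le> s" and "s \<le> t"
    and "k_connected k V E"
    and "bipartite_parts V E s t"
    and "min_spanning_k_connected k V E F"
    and "card F = k * t"
  shows "mc k V E = card E - k * t + 1"
proof -
  have finV: "finite V" and "E \<subseteq> Pow V"
    using assms(4) unfolding k_connected_def simple_graph_def by auto
  then have finE: "finite E" by (meson finite_Pow_iff finite_subset)
  have F: "F \<subseteq> E" "k_connected k V F" using assms(6) unfolding min_spanning_k_connected_def by auto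
  have pos: "0 < k * t" "1 \<le> k" using assms(1-3) by auto
  then have "F \<noteq> {}" using assms(7) by auto
  \<comment> \<open>This makes the truncated subtraction in the claim exact.\<close>
  have kt: "k * t \<le> card E" using card_mono[OF finE F(1)] assms(7) by simp
  obtain c :: "'a set \<Rightarrow> nat" where c: "\<And>e. e \<in> F \<Longrightarrow> c e = 0"
    "card (c ` E) = card E - card F + 1"
    using ex_colouring_constant_on[OF finE F(1) \<open>F \<noteq> {}\<close>] by blast
  have mono: "mono_k_connected_colouring k V E c"
    using mono_k_connected_colouring_if_constant_on[OF F(2,1) pos(2), of c 0] c(1) by blast
  show ?thesis
    unfolding mc_def
  proof (rule Max_eqI)
    show "finite {card (c ` E) | c :: 'a set \<Rightarrow> nat. mono_k_connected_colouring k V E c}"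
      by (rule finite_subset[of _ "{..card E}"]) (use finE in \<open>auto intro: card_image_le\<close>)
  next
    fix n assume "n \<in> {card (c ` E) | c :: 'a set \<Rightarrow> nat. mono_k_connected_colouring k V E c}"
    then obtain d :: "'a set \<Rightarrow> nat" where "n = card (d ` E)" "mono_k_connected_colouring k V E d"
      by blast
    then show "n \<le> card E - k * t + 1"
      using card_colours_le[OF assms(1-3) assms(5) finV] kt by fastforce
  next
    show "card E - k * t + 1 \<in> {card (c ` E) | c :: 'a set \<Rightarrow> nat. mono_k_connected_colouring k V E c}"
      using mono c(2) assms(7) by (auto intro!: exI[of _ c])
  qed
qed

end
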